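(* Let $p\ge 1$ be an integer and $Q>0$. Let $\pi_n$ ($n\ge1$) be a sequence of priors (probability measures) on $E_p(Q)$ and let $\Pi_n$ be the prior induced by $\pi_n$ on $\mathscr{F}=\{f_{\boldsymbol\theta}:\boldsymbol\theta\in E_p(Q)\}$ via the map $\boldsymbol\theta\mapsto f_{\boldsymbol\theta}$. Suppose $\boldsymbol\theta_0=(\theta_{0,0},\theta_{0,1},\dots)\in E_p(Q)$ and let $P_0=P_{\boldsymbol\theta_0}$. Let $B_1^2=e^{-8B}$ and $\varepsilon_n=n^{-p/(2p+1)}$. If there are constants $c_1,c_2>0$ such that for all sufficiently large $n$ $$\pi_n\Big(\Big\{\boldsymbol\theta:\ \sum_{j=1}^{\infty}(\theta_j-\theta_{0,j})^2\le B_1^2\varepsilon_n^2\Big\}\Big)\ \ge\ c_2e^{-c_1n\varepsilon_n^2},$$ then for a sufficiently large constant $M>0$, $$\Pi_n\big(\{P_{\boldsymbol\theta}:\ d_{\mathrm H}(P_0,P_{\boldsymbol\theta})>M\varepsilon_n\}\,\big|\,X_1,\dots,X_n\big)\to0\quad\text{as } n\to\infty,$$ $P_0^\infty$-almost surely, where $P_0^\infty$ is the infinite product measure of $P_0$.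
   Context: Trigonometric system on $[0,1]$: $\phi_0\equiv1$ and, for $k\ge1$, $\phi_{2k-1}(x)=\sqrt2\sin(2\pi kx)$, $\phi_{2k}(x)=\sqrt2\cos(2\pi kx)$. Sequences $\boldsymbol\theta=(\theta_0,\theta_1,\dots)$ are real. Put $v_0=0$ and, for $j\ge1$, $v_j=j+1$ if $j$ is odd, $v_j=j$ if $j$ is even. For an integer $p\ge1$ and $Q>0$ the Sobolev ellipsoid is $E_p(Q)=\{\boldsymbol\theta\in\ell_2:\sum_{j=0}^\infty v_j^{2p}\theta_j^2<Q\}$. Constants: $A=\sum_{j=1}^\infty v_j^{-2p}$ and $B=\sqrt{2QA}$. For $\boldsymbol\theta\in E_p(Q)$, $P_{\boldsymbol\theta}$ is the probability measure on $[0,1]$ with Lebesgue density $$f_{\boldsymbol\theta}(x)=\frac{\exp\{\sum_{j=1}^\infty\theta_j\phi_j(x)\}}{\int_0^1\exp\{\sum_{j=1}^\infty\theta_j\phi_j(t)\}\,dt},\qquad x\in[0,1]$$ (it does not depend on $\theta_0$). $\mathscr F$ denotes both the class of densities $\{f_{\boldsymbol\theta}:\boldsymbol\theta\in E_p(Q)\}$ and the class of the corresponding measures $P_{\boldsymbol\theta}$. The Hellinger distance is $d_{\mathrm H}(P_{\boldsymbol\theta'},P_{\boldsymbol\theta})=\{\int_0^1(\sqrt{f_{\boldsymbol\theta'}}-\sqrt{f_{\boldsymbol\theta}})^2\,dx\}^{1/2}$. The observations $X_1,X_2,\dots$ are i.i.d. from $P_0$, and the posterior is given by Bayes' formula: $\Pi_n(C\mid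 X_1,\dots,X_n)=\int_{\{\boldsymbol\theta:P_{\boldsymbol\theta}\in C\}}\prod_{i=1}^nf_{\boldsymbol\theta}(X_i)\,\pi_n(d\boldsymbol\theta)\big/\int\prod_{i=1}^nf_{\boldsymbol\theta}(X_i)\,\pi_n(d\boldsymbol\theta)$. *)

theory Defs
  imports "HOL-Probability.Probability"
begin

abbreviation lborel01 :: "real measure" where
  "lborel01 \<equiv> restrict_space lborel {0..1}"

definition trig_basis :: "nat \<Rightarrow> real \<Rightarrow> real" where
  "trig_basis j x =
     (if j = 0 then 1
      else if odd j then sqrt 2 * sin (2 * pi * real ((j + 1) div 2) * x)
      else sqrt 2 * cos (2 * pi * real (j div 2) * x))"

lemma trig_basis_sin: "k \<ge> 1 \<Longrightarrow> trig_basis (2 * k - 1) x = sqrt 2 * sin (2 * pi * real k * x)"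
  by (auto simp: trig_basis_def)

lemma trig_basis_cos: "k \<ge> 1 \<Longrightarrow> trig_basis (2 * k) x = sqrt 2 * cos (2 * pi * real k * x)"
  by (auto simp: trig_basis_def)

definition sobolev_weight :: "nat \<Rightarrow> real" where
  "sobolev_weight j = (if odd j then real j + 1 else real j)"

text \<open>Summability is required explicitly, because \<^const>\<open>suminf\<close> carries no information
  for divergent series.\<close>

definition sobolev_ellipsoid :: "nat \<Rightarrow> real \<Rightarrow> (nat \<Rightarrow> real) set" where
  "sobolev_ellipsoid p Q =
     {\<theta>. summable (\<lambda>j. (\<theta> j)\<^sup>2) \<and>
          summable (\<lambda>j. sobolev_weight j ^ (2 * p) * (\<theta> j)\<^sup>2) \<and>
          (\<Sum>j. sobolev_weight j ^ (2 * p) * (\<theta> j)\<^sup>2) < Q}"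

text \<open>Sums over \<open>j \<ge> 1\<close> are written as sums over \<open>Suc j\<close>.\<close>

definition sobolev_A :: "nat \<Rightarrow> real" where
  "sobolev_A p = (\<Sum>j. 1 / sobolev_weight (Suc j) ^ (2 * p))"

definition sobolev_B :: "nat \<Rightarrow> real \<Rightarrow> real" where
  "sobolev_B p Q = sqrt (2 * Q * sobolev_A p)"

definition log_series :: "(nat \<Rightarrow> real) \<Rightarrow> real \<Rightarrow> real" where
  "log_series \<theta> x = (\<Sum>j. \<theta> (Suc j) * trig_basis (Suc j) x)"

definition exp_density :: "(nat \<Rightarrow> real) \<Rightarrow> real \<Rightarrow> real" where
  "exp_density \<theta> x = exp (log_series \<theta> x) / (LINT t|lborel01. exp (log_series \<theta> t))"

definition exp_measure :: "(nat \<Rightarrow> real) \<Rightarrow> real measure" where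
  "exp_measure \<theta> = density lborel01 (\<lambda>x. ennreal (exp_density \<theta> x))"

text \<open>The Hellinger distance of two measures, given by their Lebesgue densities on \<open>[0,1]\<close>.\<close>

definition hellinger_dist :: "(real \<Rightarrow> real) \<Rightarrow> (real \<Rightarrow> real) \<Rightarrow> real" where
  "hellinger_dist f g = sqrt (LINT x|lborel01. (sqrt (f x) - sqrt (g x))\<^sup>2)"

text \<open>The \<open>\<sigma>\<close>-algebra on the ellipsoid is the trace of the product \<open>\<sigma>\<close>-algebra on real sequences.
  It coincides with the Borel \<open>\<sigma>\<close>-algebra of the \<open>\<ell>\<^sub>2\<close>-norm.\<close>

definition prior_on_ellipsoid :: "nat \<Rightarrow> real \<Rightarrow> (nat \<Rightarrow> real) measure \<Rightarrow> bool" where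
  "prior_on_ellipsoid p Q \<mu> \<longleftrightarrow>
     prob_space \<mu> \<and>
     sets \<mu> = sets (restrict_space (\<Pi>\<^sub>M j\<in>UNIV. borel) (sobolev_ellipsoid p Q))"

text \<open>The observations \<open>X\<^sub>1, \<dots>, X\<^sub>n\<close> are \<open>X 0, \<dots>, X (n - 1)\<close>.\<close>

definition likelihood :: "nat \<Rightarrow> (nat \<Rightarrow> real) \<Rightarrow> (nat \<Rightarrow> real) \<Rightarrow> real" where
  "likelihood n X \<theta> = (\<Prod>i<n. exp_density \<theta> (X i))"

definition posterior ::
  "(nat \<Rightarrow> real) measure \<Rightarrow> nat \<Rightarrow> (nat \<Rightarrow> real) \<Rightarrow> real measure set \<Rightarrow> real" where
  "posterior \<mu> n X C =
     (LINT \<theta>:{\<theta> \<in> space \<mu>. exp_measure \<theta> \<in> C}|\<mu>. likelihood n X \<theta>) /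
     (LINT \<theta>|\<mu>. likelihood n X \<theta>)"

end

theory Submission
  imports Defs "HOL-Real_Asymp.Real_Asymp"
begin

text \<open>
  The model is an exponential family, so the log-likelihood ratio of \<open>n\<close> observations splits exactly
  into
    \<open>\<Sum>i<n. log (f\<^sub>\<theta> (X i) / f\<^sub>0 (X i)) = (\<Sum>j. (\<theta> j - \<theta>0 j) * S j) - n * KL(P\<^sub>0, P\<^sub>\<theta>)\<close>
  where \<open>S j\<close> is the sum over the observations of the \<open>j\<close>-th basis function centred under \<open>P\<^sub>0\<close>
  (\<open>likelihood_exp_family\<close>). All randomness sits in the single vector \<open>S\<close>, and the proof compares
  its size with the drift \<open>n * KL\<close> for all parameters simultaneously.

  Drift. The log-densities of the ellipsoid are bounded by \<open>B\<close>, hence the Kullback--Leibler divergence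
  is at least the squared Hellinger distance and is equivalent to the squared \<open>\<ell>\<^sub>2\<close>-distance \<open>D\<close> of the
  parameters (\<open>exp_family_KL_facts\<close>).

  Fluctuation. Weight the coordinates by \<open>w j = 1 / (1 + \<epsilon>\<^sub>n\<^sup>2 * v\<^sub>j ^ (2 * p))\<close>. By Cauchy--Schwarz
  the linear term is at most the square root of
    \<open>(\<Sum>j. (\<theta> j - \<theta>0 j)\<^sup>2 / w j) * (\<Sum>j. w j * (S j)\<^sup>2)\<close>.
  The first factor is at most \<open>D + 4 * Q * \<epsilon>\<^sub>n\<^sup>2\<close> on the ellipsoid. The weights sum to at most a
  multiple of the effective dimension \<open>N = n * \<epsilon>\<^sub>n\<^sup>2 = n powr (1 / (2 * p + 1))\<close>, so the second factor
  has mean of order \<open>n * N = (n * \<epsilon>\<^sub>n)\<^sup>2\<close>. It stays of this order almost surely for all large \<open>n\<close>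
  (\<open>empirical_energy_AE_bound\<close>): a recursion over the observations bounds its moments of order \<open>m\<close>
  proportional to \<open>N\<close>, so exceedance has probability at most \<open>exp (- N)\<close>, which is summable
  (\<open>energy_tail\<close>). Consequently the linear term is at most \<open>n * KL / 2\<close> plus a multiple of
  \<open>n * \<epsilon>\<^sub>n\<^sup>2\<close> for all \<open>\<theta>\<close> in the ellipsoid (\<open>linear_statistic_bound\<close>).

  Posterior. At Hellinger distance above \<open>M * \<epsilon>\<^sub>n\<close> the drift wins, and the likelihood ratio is at most
  \<open>exp (- n * \<epsilon>\<^sub>n\<^sup>2 * (M\<^sup>2 / 2 - const))\<close>. On the ball in the prior mass condition, whose radius is at most
  \<open>\<epsilon>\<^sub>n\<close>, it is at least \<open>exp (- const * n * \<epsilon>\<^sub>n\<^sup>2)\<close>. The quotient of the two integrals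
  therefore tends to zero once \<open>M\<close> is large compared with \<open>c1\<close> and the constants (\<open>posterior_bound\<close>).\<close>

section \<open>Series and exponential inequalities\<close>

lemma Cauchy_Schwarz_suminf:
  fixes a b :: "nat \<Rightarrow> real"
  assumes a: "summable (\<lambda>j. (a j)\<^sup>2)" and b: "summable (\<lambda>j. (b j)\<^sup>2)"
  shows "summable (\<lambda>j. \<bar>a j * b j\<bar>)"
    and "(\<Sum>j. \<bar>a j * b j\<bar>) \<le> sqrt (\<Sum>j. (a j)\<^sup>2) * sqrt (\<Sum>j. (b j)\<^sup>2)"
    and "\<bar>\<Sum>j. a j * b j\<bar> \<le> sqrt (\<Sum>j. (a j)\<^sup>2) * sqrt (\<Sum>j. (b j)\<^sup>2)"
proof -
  let ?R = "sqrt (\<Sum>j. (a j)\<^sup>2) * sqrt (\<Sum>j. (b j)\<^sup>2)"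
  have part: "(\<Sum>j<n. \<bar>a j * b j\<bar>) \<le> ?R" for n
  proof -
    have "(\<Sum>j<n. \<bar>a j * b j\<bar>)\<^sup>2 \<le> (\<Sum>j<n. (a j)\<^sup>2) * (\<Sum>j<n. (b j)\<^sup>2)"
      using Cauchy_Schwarz_ineq_sum[of "\<lambda>j. \<bar>a j\<bar>" "\<lambda>j. \<bar>b j\<bar>" "{..<n}"] by (simp add: abs_mult)
    also have "\<dots> \<le> (\<Sum>j. (a j)\<^sup>2) * (\<Sum>j. (b j)\<^sup>2)"
      by (intro mult_mono sum_le_suminf a b suminf_nonneg sum_nonneg) auto
    finally show ?thesis
      by (metis real_le_rsqrt real_sqrt_mult)
  qed
  show s: "summable (\<lambda>j. \<bar>a j * b j\<bar>)"
    by (rule bounded_imp_summable[OF _ part[of "Suc _", unfolded lessThan_Suc_atMost]]) simp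
  show le: "(\<Sum>j. \<bar>a j * b j\<bar>) \<le> ?R"
    by (rule suminf_le_const[OF s part])
  show "\<bar>\<Sum>j. a j * b j\<bar> \<le> ?R"
    using summable_rabs[OF s] le by linarith
qed

text \<open>Taylor's formula with Lagrange remainder. The upper bound at \<open>b = 1\<close> also drives the moment
  recursion for the empirical coefficients.\<close>

lemma exp_quadratic_bounds:
  fixes t b :: real
  assumes "\<bar>t\<bar> \<le> b"
  shows "exp t \<le> 1 + t + exp b / 2 * t\<^sup>2" and "1 + t + exp (- b) / 2 * t\<^sup>2 \<le> exp t"
proof -
  obtain s where s: "\<bar>s\<bar> \<le> \<bar>t\<bar>" "exp t = (\<Sum>m<2. t ^ m / fact m) + exp s / fact 2 * t\<^sup>2"
    using Maclaurin_exp_le[of t 2] by auto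
  have e: "exp t = 1 + t + exp s / 2 * t\<^sup>2"
    using s(2) by (simp add: numeral_2_eq_2)
  have "exp s \<le> exp b" "exp (- b) \<le> exp s"
    using s(1) assms by auto
  then show "exp t \<le> 1 + t + exp b / 2 * t\<^sup>2" "1 + t + exp (- b) / 2 * t\<^sup>2 \<le> exp t"
    unfolding e by (auto intro!: mult_right_mono)
qed

section \<open>Log-normalisers of bounded centred variables\<close>

text \<open>For \<open>g\<close> the centred log-likelihood ratio, \<open>L\<close> will be a Kullback--Leibler divergence and the last
  integral a Hellinger affinity. As \<open>g\<close> is centred, the first-order term of \<open>exp\<close> integrates to
  zero, so \<open>exp L - 1\<close> is half the variance of \<open>g\<close> up to factors \<open>exp b\<close>; passing from \<open>exp L - 1\<close> to
  \<open>L\<close> costs at most another factor \<open>exp b\<close>. The last inequality is \<open>exp t \<ge> 1 + t\<close> integrated.\<close>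

lemma (in prob_space) log_normaliser_bounds:
  fixes g :: "'a \<Rightarrow> real"
  assumes [measurable]: "g \<in> borel_measurable M"
    and bound: "\<And>x. \<bar>g x\<bar> \<le> b" and mean: "(LINT x|M. g x) = 0"
  defines "L \<equiv> ln (LINT x|M. exp (g x))"
  shows "exp L = (LINT x|M. exp (g x))"
    and "L \<le> exp b / 2 * (LINT x|M. (g x)\<^sup>2)"
    and "exp (- 2 * b) / 2 * (LINT x|M. (g x)\<^sup>2) \<le> L"
    and "2 - 2 * (LINT x|M. exp ((g x - L) / 2)) \<le> L"
proof -
  have b0: "0 \<le> b" using bound[of undefined] by linarith
  have ig[simp]: "integrable M g"
    by (rule integrable_const_bound[where B = b]) (use bound in auto)
  have ig2[simp]: "integrable M (\<lambda>x. (g x)\<^sup>2)"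
    by (rule integrable_const_bound[where B = "b\<^sup>2"])
       (use bound in \<open>auto simp: abs_le_square_iff[symmetric] intro!: AE_I2 power_mono\<close>, metis abs_le_square_iff abs_of_nonneg b0)
  have ie[simp]: "integrable M (\<lambda>x. exp (c * g x + d))" if "0 \<le> c" for c d
    by (rule integrable_const_bound[where B = "exp (c * b + d)"])
       (use bound that in \<open>auto intro!: AE_I2 mult_left_mono dest: abs_le_D1\<close>)
  have ie1[simp]: "integrable M (\<lambda>x. exp (g x))"
    using ie[of 1 0] by simp
  let ?E = "LINT x|M. exp (g x)" and ?V = "LINT x|M. (g x)\<^sup>2"
  have V0: "0 \<le> ?V" by (rule integral_nonneg_AE) auto
  have up: "?E \<le> 1 + exp b / 2 * ?V"
  proof -
    have "?E \<le> (LINT x|M. 1 + g x + exp b / 2 * (g x)\<^sup>2)"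
      by (intro integral_mono exp_quadratic_bounds(1) bound) auto
    also have "\<dots> = 1 + exp b / 2 * ?V" by (simp add: mean prob_space)
    finally show ?thesis .
  qed
  have lo: "1 + exp (- b) / 2 * ?V \<le> ?E"
  proof -
    have "(LINT x|M. 1 + g x + exp (- b) / 2 * (g x)\<^sup>2) \<le> ?E"
      by (intro integral_mono exp_quadratic_bounds(2) bound) auto
    also have "(LINT x|M. 1 + g x + exp (- b) / 2 * (g x)\<^sup>2) = 1 + exp (- b) / 2 * ?V"
      by (simp add: mean prob_space)
    finally show ?thesis .
  qed
  have E1: "1 \<le> ?E" using lo V0 by (smt (verit) exp_gt_zero half_gt_zero_iff mult_nonneg_nonneg)
  have Eb: "?E \<le> exp b"
  proof -
    have "?E \<le> (LINT x|M. exp b)"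
      by (intro integral_mono) (use bound in \<open>auto dest: abs_le_D1\<close>)
    then show ?thesis by (simp add: prob_space)
  qed
  show expL: "exp L = ?E" using E1 by (simp add: L_def)
  show "L \<le> exp b / 2 * ?V"
    using up ln_le_minus_one[of ?E] E1 unfolding L_def by linarith
  \<comment> \<open>\<open>ln x \<ge> 1 - 1 / x\<close>, whose loss compared with \<open>x - 1\<close> is the factor \<open>x \<le> exp b\<close>\<close>
  have "1 - inverse ?E \<le> L"
    using ln_le_minus_one[of "inverse ?E"] E1 by (simp add: L_def ln_inverse)
  moreover have "exp (- 2 * b) / 2 * ?V \<le> 1 - inverse ?E"
  proof -
    have "exp (- 2 * b) / 2 * ?V = (exp (- b) / 2 * ?V) * exp (- b)"
      by (simp add: exp_add[symmetric])
    also have "\<dots> \<le> (?E - 1) * inverse ?E"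
      using lo E1 Eb V0 by (intro mult_mono) (auto simp: exp_minus intro!: le_imp_inverse_le)
    also have "\<dots> = 1 - inverse ?E" using E1 by (simp add: field_simps)
    finally show ?thesis .
  qed
  ultimately show "exp (- 2 * b) / 2 * ?V \<le> L" by linarith
  have "(LINT x|M. 1 + (g x - L) / 2) \<le> (LINT x|M. exp ((g x - L) / 2))"
    using ie[of "1/2" "- L / 2"] by (intro integral_mono) (auto simp: diff_divide_distrib exp_ge_add_one_self)
  also have "(LINT x|M. 1 + (g x - L) / 2) = 1 - L / 2"
    by (simp add: mean prob_space)
  finally show "2 - 2 * (LINT x|M. exp ((g x - L) / 2)) \<le> L" by linarith
qed

section \<open>The trigonometric system\<close>

lemma prob_space_lborel01: "prob_space lborel01"
  by (rule prob_spaceI) (simp add: emeasure_restrict_space)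

lemma borel_measurable_lborel01: "g \<in> borel_measurable borel \<Longrightarrow> g \<in> borel_measurable lborel01"
  for g :: "real \<Rightarrow> real"
  by (simp add: measurable_restrict_space1)

text \<open>A sine is a cosine with phase \<open>- pi / 2\<close>. In this form all products of basis functions are sums of
  two shifted cosines, and orthonormality follows from one integral.\<close>

lemma trig_basis_cos_phase:
  "trig_basis (Suc j) x =
     sqrt 2 * cos (2 * pi * real (j div 2 + 1) * x + (if odd (Suc j) then - pi / 2 else 0))"
  by (auto simp: trig_basis_def cos_diff elim!: evenE oddE)

lemma trig_basis_measurable [measurable]: "trig_basis j \<in> borel_measurable borel"
  unfolding trig_basis_def[abs_def] by measurable

lemma trig_basis_bound: "\<bar>trig_basis (Suc j) x\<bar> \<le> sqrt 2"
  using abs_cos_le_one unfolding trig_basis_cos_phase by (simp add: abs_mult)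

lemma integral_cos_full_period:
  fixes k :: int
  assumes "k \<noteq> 0"
  shows "(LINT x|lborel01. cos (2 * pi * real_of_int k * x + c)) = 0"
proof -
  define w where "w = 2 * pi * real_of_int k"
  have w: "w \<noteq> 0" using assms by (simp add: w_def)
  have "(LINT x|lborel01. cos (w * x + c)) = (LINT x|lborel. indicator {0..1} x *\<^sub>R cos (w * x + c))"
    by (subst integral_restrict_space) auto
  also have "\<dots> = sin (w * 1 + c) / w - sin (w * 0 + c) / w"
    by (rule integral_FTC_Icc)
       (use w in \<open>auto intro!: derivative_eq_intros continuous_intros
          simp: has_real_derivative_iff_has_vector_derivative[symmetric]\<close>)
  also have "sin (w * 1 + c) = sin c"
    using sin_cos_eq_iff sin_add[of w c] sin_int_2pin[of k] cos_int_2pin[of k] by (simp add: w_def)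
  finally show ?thesis by (simp add: w_def)
qed

lemma trig_basis_mean: "(LINT x|lborel01. trig_basis (Suc j) x) = 0"
  using integral_cos_full_period[of "int (j div 2 + 1)"]
  unfolding trig_basis_cos_phase by simp

lemma trig_basis_orthonormal:
  "(LINT x|lborel01. trig_basis (Suc j) x * trig_basis (Suc k) x) = (if j = k then 1 else 0)"
proof -
  interpret prob_space lborel01 by (rule prob_space_lborel01)
  let ?s = "\<lambda>j. (if odd (Suc j) then - pi / 2 else 0)" and ?f = "\<lambda>j::nat. j div 2 + 1"
  let ?m = "int (?f j) - int (?f k)" and ?p = "int (?f j) + int (?f k)"
  have int[simp]: "integrable lborel01 (\<lambda>x. cos (a * x + c))" for a c
    by (rule integrable_const_bound[where B = 1]) (auto intro!: borel_measurable_lborel01)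
  have "trig_basis (Suc j) x * trig_basis (Suc k) x =
      cos (2 * pi * real_of_int ?m * x + (?s j - ?s k)) + cos (2 * pi * real_of_int ?p * x + (?s j + ?s k))" for x
  proof -
    have "trig_basis (Suc j) x * trig_basis (Suc k) x =
       2 * (cos (2 * pi * real (?f j) * x + ?s j) * cos (2 * pi * real (?f k) * x + ?s k))"
      unfolding trig_basis_cos_phase by simp
    also have "\<dots> = cos ((2 * pi * real (?f j) * x + ?s j) - (2 * pi * real (?f k) * x + ?s k)) +
        cos ((2 * pi * real (?f j) * x + ?s j) + (2 * pi * real (?f k) * x + ?s k))"
      unfolding cos_times_cos by simp
    also have "(2 * pi * real (?f j) * x + ?s j) - (2 * pi * real (?f k) * x + ?s k) =
        2 * pi * real_of_int ?m * x + (?s j - ?s k)"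
      by (simp add: algebra_simps)
    also have "(2 * pi * real (?f j) * x + ?s j) + (2 * pi * real (?f k) * x + ?s k) =
        2 * pi * real_of_int ?p * x + (?s j + ?s k)"
      by (simp add: algebra_simps)
    finally show ?thesis .
  qed
  then have "(LINT x|lborel01. trig_basis (Suc j) x * trig_basis (Suc k) x) =
      (LINT x|lborel01. cos (2 * pi * real_of_int ?m * x + (?s j - ?s k))) +
      (LINT x|lborel01. cos (2 * pi * real_of_int ?p * x + (?s j + ?s k)))"
    by (simp only: Bochner_Integration.integral_add[OF int int])
  also have "(LINT x|lborel01. cos (2 * pi * real_of_int ?p * x + (?s j + ?s k))) = 0"
    by (rule integral_cos_full_period) simp
  also have "(LINT x|lborel01. cos (2 * pi * real_of_int ?m * x + (?s j - ?s k))) + 0 = (if j = k then 1 else 0)"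
  proof (cases "?m = 0")
    case True
    then have "j div 2 = k div 2" by simp
    then have "j = k \<or> (odd (Suc j) \<longleftrightarrow> \<not> odd (Suc k))"
      by (metis div_mult_mod_eq even_Suc odd_iff_mod_2_eq_one even_iff_mod_2_eq_zero)
    then show ?thesis using True prob_space by auto
  next
    case False
    then have "j \<noteq> k" by auto
    then show ?thesis using integral_cos_full_period[OF False] by simp
  qed
  finally show ?thesis .
qed

definition trig_series :: "(nat \<Rightarrow> real) \<Rightarrow> real \<Rightarrow> real" where
  "trig_series b x = (\<Sum>j. b j * trig_basis (Suc j) x)"

lemma trig_series_measurable [measurable]: "trig_series b \<in> borel_measurable borel"
  unfolding trig_series_def[abs_def] by measurable

lemma trig_series_summable:
  assumes "summable (\<lambda>j. \<bar>b j\<bar>)"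
  shows "summable (\<lambda>j. \<bar>b j * trig_basis (Suc j) x\<bar>)" "summable (\<lambda>j. b j * trig_basis (Suc j) x)"
proof -
  show s: "summable (\<lambda>j. \<bar>b j * trig_basis (Suc j) x\<bar>)"
    by (rule summable_comparison_test'[where g = "\<lambda>j. \<bar>b j\<bar> * sqrt 2" and N = 0])
       (auto intro!: summable_mult2 assms mult_left_mono trig_basis_bound simp: abs_mult)
  show "summable (\<lambda>j. b j * trig_basis (Suc j) x)"
    by (rule summable_rabs_cancel[OF s])
qed

lemma trig_series_bound:
  assumes "summable (\<lambda>j. \<bar>b j\<bar>)"
  shows "\<bar>trig_series b x\<bar> \<le> sqrt 2 * (\<Sum>j. \<bar>b j\<bar>)"
proof -
  have "\<bar>trig_series b x\<bar> \<le> (\<Sum>j. \<bar>b j * trig_basis (Suc j) x\<bar>)"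
    unfolding trig_series_def by (rule summable_rabs[OF trig_series_summable(1)[OF assms]])
  also have "\<dots> \<le> (\<Sum>j. sqrt 2 * \<bar>b j\<bar>)"
    by (intro suminf_le trig_series_summable assms summable_mult)
       (auto simp: abs_mult mult.commute[of _ "sqrt 2"] intro!: mult_left_mono trig_basis_bound,
      metis abs_ge_zero mult.commute mult_left_mono trig_basis_bound)
  finally show ?thesis by (simp add: suminf_mult assms)
qed

text \<open>Termwise integration against a bounded factor; the factor \<open>1\<close> gives the mean of a
  trigonometric series, another trigonometric series gives Parseval's identity.\<close>

lemma integral_trig_series:
  fixes M :: "real measure"
  assumes "finite_measure M" and sets: "sets M = sets lborel01"
    and b: "summable (\<lambda>j. \<bar>b j\<bar>)"
    and g [measurable]: "g \<in> borel_measurable borel" and gb: "\<And>x. \<bar>g x\<bar> \<le> c"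
  shows "(LINT x|M. trig_series b x * g x) = (\<Sum>j. b j * (LINT x|M. trig_basis (Suc j) x * g x))"
    and "summable (\<lambda>j. b j * (LINT x|M. trig_basis (Suc j) x * g x))"
proof -
  interpret finite_measure M by fact
  have mM: "h \<in> borel_measurable M" if "h \<in> borel_measurable borel" for h :: "real \<Rightarrow> real"
    using borel_measurable_lborel01[OF that] by (simp add: measurable_cong_sets[OF sets refl])
  let ?f = "\<lambda>j x. b j * (trig_basis (Suc j) x * g x)"
  have c0: "0 \<le> c" using gb[of 0] by linarith
  have fb: "\<bar>?f j x\<bar> \<le> \<bar>b j\<bar> * (sqrt 2 * c)" for j x
    unfolding abs_mult by (intro mult_left_mono mult_mono trig_basis_bound gb) auto
  have i: "integrable M (?f j)" for j
    by (rule integrable_const_bound[where B = "\<bar>b j\<bar> * (sqrt 2 * c)"]) (use fb in \<open>auto intro!: mM\<close>)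
  have 1: "AE x in M. summable (\<lambda>j. norm (?f j x))"
    by (rule AE_I2, rule summable_comparison_test'[where g = "\<lambda>j. \<bar>b j\<bar> * (sqrt 2 * c)" and N = 0])
       (use fb summable_mult2[OF b] in auto)
  have 2: "summable (\<lambda>j. LINT x|M. norm (?f j x))"
  proof (rule summable_comparison_test'[where g = "\<lambda>j. \<bar>b j\<bar> * (sqrt 2 * c) * measure M (space M)" and N = 0])
    show "summable (\<lambda>j. \<bar>b j\<bar> * (sqrt 2 * c) * measure M (space M))"
      by (intro summable_mult2 b)
    fix j :: nat
    have "(LINT x|M. norm (?f j x)) \<le> (LINT x|M. \<bar>b j\<bar> * (sqrt 2 * c))"
      by (intro integral_mono integrable_norm i) (use fb in auto)
    then show "norm (LINT x|M. norm (?f j x)) \<le> \<bar>b j\<bar> * (sqrt 2 * c) * measure M (space M)"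
      by (simp add: mult_ac)
  qed
  have e: "trig_series b x * g x = (\<Sum>j. ?f j x)" for x
    unfolding trig_series_def
    by (subst suminf_mult2[OF trig_series_summable(2)[OF b]]) (simp add: mult_ac)
  show "(LINT x|M. trig_series b x * g x) = (\<Sum>j. b j * (LINT x|M. trig_basis (Suc j) x * g x))"
    unfolding e using integral_suminf[OF i 1 2] by simp
  show "summable (\<lambda>j. b j * (LINT x|M. trig_basis (Suc j) x * g x))"
    using summable_integral[OF i 1 2] by simp
qed

text \<open>Two termwise integrations: against \<open>trig_basis (Suc k)\<close> to identify the coefficients, and then
  against the series itself.\<close>

lemma Parseval_trig_series:
  assumes b: "summable (\<lambda>j. \<bar>b j\<bar>)"
  shows "(LINT x|lborel01. (trig_series b x)\<^sup>2) = (\<Sum>j. (b j)\<^sup>2)"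
    and "(LINT x|lborel01. trig_series b x) = 0"
proof -
  interpret prob_space lborel01 by (rule prob_space_lborel01)
  have coeff: "(LINT x|lborel01. trig_basis (Suc k) x * trig_series b x) = b k" for k
  proof -
    have "(LINT x|lborel01. trig_basis (Suc k) x * trig_series b x) =
        (\<Sum>j. b j * (LINT x|lborel01. trig_basis (Suc j) x * trig_basis (Suc k) x))"
      using integral_trig_series(1)[OF finite_measure_axioms refl b trig_basis_measurable trig_basis_bound[of k]]
      by (simp only: mult.commute)
    also have "\<dots> = (\<Sum>j. if j = k then b j else 0)"
      by (intro suminf_cong) (simp add: trig_basis_orthonormal)
    also have "\<dots> = b k"
      using suminf_finite[of "{k}" "\<lambda>j. if j = k then b j else 0"] by simp
    finally show ?thesis .
  qed
  show "(LINT x|lborel01. (trig_series b x)\<^sup>2) = (\<Sum>j. (b j)\<^sup>2)"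
    using integral_trig_series(1)[OF finite_measure_axioms refl b trig_series_measurable trig_series_bound[OF b]]
    by (simp add: coeff power2_eq_square)
  show "(LINT x|lborel01. trig_series b x) = 0"
    using integral_trig_series(1)[OF finite_measure_axioms refl b, of "\<lambda>_. 1" 1] by (simp add: trig_basis_mean)
qed

section \<open>The Sobolev ellipsoid\<close>

lemma sobolev_weight_ge: "real (Suc j) \<le> sobolev_weight (Suc j)"
  by (auto simp: sobolev_weight_def)

lemma sobolev_weight_pos: "0 < sobolev_weight (Suc j)"
  using sobolev_weight_ge[of j] by linarith

lemma sobolev_weight_power_ge:
  assumes "p \<ge> 1"
  shows "(real (Suc j))\<^sup>2 \<le> sobolev_weight (Suc j) ^ (2 * p)"
proof -
  have "(real (Suc j))\<^sup>2 \<le> real (Suc j) ^ (2 * p)"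
    by (rule power_increasing) (use assms in auto)
  also have "\<dots> \<le> sobolev_weight (Suc j) ^ (2 * p)"
    by (rule power_mono) (use sobolev_weight_ge in auto)
  finally show ?thesis .
qed

lemma summable_inverse_sobolev_weight:
  assumes "p \<ge> 1"
  shows "summable (\<lambda>j. 1 / sobolev_weight (Suc j) ^ (2 * p))"
proof (rule summable_comparison_test'[where g = "\<lambda>j. inverse ((real (Suc j))\<^sup>2)" and N = 0])
  show "summable (\<lambda>j. inverse ((real (Suc j))\<^sup>2))"
    using inverse_power_summable[of 2, where 'a = real] by (subst summable_Suc_iff) simp
  show "norm (1 / sobolev_weight (Suc j) ^ (2 * p)) \<le> inverse ((real (Suc j))\<^sup>2)" for j
    using sobolev_weight_power_ge[OF assms, of j] sobolev_weight_pos[of j]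
    by (simp add: divide_inverse le_imp_inverse_le)
qed

text \<open>The zeroth coefficient has weight \<open>0\<close>, so the ellipsoid constrains precisely the coefficients that
  enter the density.\<close>

lemma sobolev_ellipsoid_tail:
  assumes p: "p \<ge> 1" and \<theta>: "\<theta> \<in> sobolev_ellipsoid p Q"
  shows "summable (\<lambda>j. sobolev_weight (Suc j) ^ (2 * p) * (\<theta> (Suc j))\<^sup>2)"
    and "(\<Sum>j. sobolev_weight (Suc j) ^ (2 * p) * (\<theta> (Suc j))\<^sup>2) < Q"
    and "summable (\<lambda>j. (\<theta> (Suc j))\<^sup>2)"
proof -
  let ?f = "\<lambda>j. sobolev_weight j ^ (2 * p) * (\<theta> j)\<^sup>2"
  have s: "summable ?f" "suminf ?f < Q" "summable (\<lambda>j. (\<theta> j)\<^sup>2)"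
    using \<theta> by (auto simp: sobolev_ellipsoid_def)
  show "summable (\<lambda>j. ?f (Suc j))"
    using s(1) summable_Suc_iff[of ?f] by simp
  show "summable (\<lambda>j. (\<theta> (Suc j))\<^sup>2)"
    using s(3) summable_Suc_iff[of "\<lambda>j. (\<theta> j)\<^sup>2"] by simp
  have "?f 0 = 0" using p by (simp add: sobolev_weight_def)
  then show "(\<Sum>j. ?f (Suc j)) < Q"
    using suminf_split_head[OF s(1)] s(2) by linarith
qed

lemma sobolev_B_nonneg: "0 \<le> sobolev_B p Q" if "Q > 0" "p \<ge> 1"
  unfolding sobolev_B_def sobolev_A_def using that
  by (intro real_sqrt_ge_zero mult_nonneg_nonneg suminf_nonneg summable_inverse_sobolev_weight)
     (simp_all add: power_mult)

text \<open>Cauchy--Schwarz with the weights \<open>sobolev_weight (Suc j) ^ p\<close> and their inverses. The inverses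
  contribute the constant \<open>A\<close>, which is finite because \<open>2 * p > 1\<close>, so the log-densities of the family
  are uniformly bounded by \<open>B\<close>.\<close>

lemma sobolev_ellipsoid_absolutely_summable:
  assumes p: "p \<ge> 1" and \<theta>: "\<theta> \<in> sobolev_ellipsoid p Q"
  shows "summable (\<lambda>j. \<bar>\<theta> (Suc j)\<bar>)" and "sqrt 2 * (\<Sum>j. \<bar>\<theta> (Suc j)\<bar>) \<le> sobolev_B p Q"
proof -
  let ?V = "\<lambda>j. sobolev_weight (Suc j) ^ p"
  have V: "0 < ?V j" for j using sobolev_weight_pos by simp
  have V2: "(?V j)\<^sup>2 = sobolev_weight (Suc j) ^ (2 * p)" for j
    by (simp add: power_mult[symmetric] mult.commute)
  have a: "summable (\<lambda>j. (?V j * \<theta> (Suc j))\<^sup>2)"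
    using sobolev_ellipsoid_tail(1)[OF p \<theta>] by (simp add: power_mult_distrib V2)
  have b: "summable (\<lambda>j. (1 / ?V j)\<^sup>2)"
    using summable_inverse_sobolev_weight[OF p] by (simp add: power_divide V2)
  have e: "\<bar>?V j * \<theta> (Suc j) * (1 / ?V j)\<bar> = \<bar>\<theta> (Suc j)\<bar>" for j
    using sobolev_weight_pos[of j, THEN less_imp_neq, symmetric] by simp
  note CS = Cauchy_Schwarz_suminf[OF a b, unfolded e]
  show "summable (\<lambda>j. \<bar>\<theta> (Suc j)\<bar>)" by (rule CS(1))
  have "(\<Sum>j. \<bar>\<theta> (Suc j)\<bar>) \<le> sqrt Q * sqrt (sobolev_A p)"
  proof (rule order_trans[OF CS(2)], intro mult_mono)
    show "sqrt (\<Sum>j. (?V j * \<theta> (Suc j))\<^sup>2) \<le> sqrt Q"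
      using sobolev_ellipsoid_tail(2)[OF p \<theta>] by (simp add: power_mult_distrib V2)
    show "sqrt (\<Sum>j. (1 / ?V j)\<^sup>2) \<le> sqrt (sobolev_A p)"
      by (simp add: power_divide V2 sobolev_A_def)
    have "0 \<le> (\<Sum>j. sobolev_weight (Suc j) ^ (2 * p) * (\<theta> (Suc j))\<^sup>2)"
      by (intro suminf_nonneg sobolev_ellipsoid_tail(1)[OF p \<theta>]) (simp add: power_mult)
    then show "0 \<le> sqrt Q"
      using sobolev_ellipsoid_tail(2)[OF p \<theta>] by simp
    show "0 \<le> sqrt (\<Sum>j. (1 / ?V j)\<^sup>2)"
      by (intro real_sqrt_ge_zero suminf_nonneg b) auto
  qed
  then show "sqrt 2 * (\<Sum>j. \<bar>\<theta> (Suc j)\<bar>) \<le> sobolev_B p Q"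
    by (simp add: sobolev_B_def real_sqrt_mult mult.assoc)
qed

lemma log_series_eq_trig_series: "log_series \<theta> = trig_series (\<lambda>j. \<theta> (Suc j))"
  by (simp add: fun_eq_iff log_series_def trig_series_def)

lemma log_series_measurable [measurable]: "log_series \<theta> \<in> borel_measurable borel"
  unfolding log_series_eq_trig_series by measurable

lemma log_series_bound:
  assumes "p \<ge> 1" "\<theta> \<in> sobolev_ellipsoid p Q"
  shows "\<bar>log_series \<theta> x\<bar> \<le> sobolev_B p Q"
  unfolding log_series_eq_trig_series
  using trig_series_bound[OF sobolev_ellipsoid_absolutely_summable(1)[OF assms], of x]
    sobolev_ellipsoid_absolutely_summable(2)[OF assms] by linarith

section \<open>Densities of the exponential family\<close>

lemma integral_lborel01_bounds:
  fixes g :: "real \<Rightarrow> real"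
  assumes g: "g \<in> borel_measurable borel" and "\<And>x. l \<le> g x" "\<And>x. g x \<le> u"
  shows "integrable lborel01 g" "l \<le> (LINT x|lborel01. g x)" "(LINT x|lborel01. g x) \<le> u"
proof -
  interpret prob_space lborel01 by (rule prob_space_lborel01)
  show i: "integrable lborel01 g"
    by (rule integrable_const_bound[where B = "max \<bar>l\<bar> \<bar>u\<bar>"])
       (auto intro!: AE_I2 borel_measurable_lborel01[OF g], smt (verit) assms(2,3))
  show "l \<le> (LINT x|lborel01. g x)" using integral_ge_const[OF i] assms(2) by simp
  show "(LINT x|lborel01. g x) \<le> u" using integral_le_const[OF i] assms(3) by simp
qed

lemma exp_density_measurable [measurable]: "exp_density \<theta> \<in> borel_measurable borel"
  unfolding exp_density_def[abs_def] by measurable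

lemma sets_exp_measure: "sets (exp_measure \<theta>) = sets lborel01"
  by (simp add: exp_measure_def)

lemma borel_measurable_exp_measure:
  "g \<in> borel_measurable borel \<Longrightarrow> g \<in> borel_measurable (exp_measure \<theta>)" for g :: "real \<Rightarrow> real"
  unfolding measurable_cong_sets[OF sets_exp_measure refl, of \<theta>] by (rule borel_measurable_lborel01)

lemma exp_density_facts:
  assumes "p \<ge> 1" "\<theta> \<in> sobolev_ellipsoid p Q"
  shows "0 < (LINT t|lborel01. exp (log_series \<theta> t))"
    and "exp (- 2 * sobolev_B p Q) \<le> exp_density \<theta> x"
    and "exp_density \<theta> x \<le> exp (2 * sobolev_B p Q)"
    and "0 < exp_density \<theta> x"
    and "(LINT x|lborel01. exp_density \<theta> x) = 1"
proof -
  let ?B = "sobolev_B p Q" and ?Z = "LINT t|lborel01. exp (log_series \<theta> t)"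
  have b: "exp (- ?B) \<le> exp (log_series \<theta> t)" "exp (log_series \<theta> t) \<le> exp ?B" for t
    using log_series_bound[OF assms, of t] by (auto simp: abs_le_iff)
  have "(\<lambda>t. exp (log_series \<theta> t)) \<in> borel_measurable borel" by measurable
  note Z = integral_lborel01_bounds[OF this b]
  show Z0: "0 < ?Z" using Z(2) exp_gt_zero[of "- ?B"] by linarith
  have "exp (- 2 * ?B) * ?Z \<le> exp (- 2 * ?B) * exp ?B" using Z(3) by simp
  also have "\<dots> = exp (- ?B)" by (simp add: exp_add[symmetric])
  also note b(1)[of x]
  finally show 1: "exp (- 2 * ?B) \<le> exp_density \<theta> x"
    using Z0 by (simp add: exp_density_def pos_le_divide_eq)
  have "exp (log_series \<theta> x) \<le> exp ?B" by (rule b)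
  also have "\<dots> = exp (2 * ?B) * exp (- ?B)" by (simp add: exp_add[symmetric])
  also have "\<dots> \<le> exp (2 * ?B) * ?Z" using Z(2) by simp
  finally show "exp_density \<theta> x \<le> exp (2 * ?B)"
    using Z0 by (simp add: exp_density_def pos_divide_le_eq)
  show "0 < exp_density \<theta> x" using Z0 by (simp add: exp_density_def)
  show "(LINT x|lborel01. exp_density \<theta> x) = 1" using Z0 by (simp add: exp_density_def)
qed

lemma integral_exp_measure:
  assumes "p \<ge> 1" "\<theta> \<in> sobolev_ellipsoid p Q" and g: "g \<in> borel_measurable borel"
  shows "(LINT x|exp_measure \<theta>. g x) = (LINT x|lborel01. exp_density \<theta> x * g x)"
  unfolding exp_measure_def
proof (subst integral_density)
  show "AE x in lborel01. 0 \<le> exp_density \<theta> x"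
    by (rule AE_I2) (rule less_imp_le[OF exp_density_facts(4)[OF assms(1,2)]])
qed (simp_all add: borel_measurable_lborel01 g)

lemma prob_space_exp_measure:
  assumes "p \<ge> 1" "\<theta> \<in> sobolev_ellipsoid p Q"
  shows "prob_space (exp_measure \<theta>)"
proof (rule prob_spaceI)
  note d = exp_density_facts[OF assms]
  have "emeasure (exp_measure \<theta>) (space (exp_measure \<theta>)) = (\<integral>\<^sup>+x. ennreal (exp_density \<theta> x) \<partial>lborel01)"
    unfolding exp_measure_def space_density
    by (subst emeasure_density[OF _ sets.top])
       (auto intro!: nn_integral_cong borel_measurable_lborel01 measurable_compose[OF _ measurable_ennreal]
         simp: space_restrict_space)
  also have "\<dots> = ennreal (LINT x|lborel01. exp_density \<theta> x)"
    by (rule nn_integral_eq_integral[OF integral_lborel01_bounds(1)[OF _ d(2,3)]])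
       (auto intro!: d(4) less_imp_le)
  finally show "emeasure (exp_measure \<theta>) (space (exp_measure \<theta>)) = 1"
    by (simp add: d(5))
qed

lemma integral_exp_measure_compare:
  assumes "p \<ge> 1" "\<theta> \<in> sobolev_ellipsoid p Q"
    and g: "g \<in> borel_measurable borel" "\<And>x. 0 \<le> g x" "\<And>x. g x \<le> c"
  shows "(LINT x|exp_measure \<theta>. g x) \<le> exp (2 * sobolev_B p Q) * (LINT x|lborel01. g x)"
    and "exp (- 2 * sobolev_B p Q) * (LINT x|lborel01. g x) \<le> (LINT x|exp_measure \<theta>. g x)"
proof -
  note d = exp_density_facts[OF assms(1,2)]
  have i: "integrable lborel01 g" by (rule integral_lborel01_bounds(1)[OF g])
  have "0 \<le> exp_density \<theta> x * g x" "exp_density \<theta> x * g x \<le> exp (2 * sobolev_B p Q) * c" for x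
    using d(3,4)[of x] g(2,3)[of x] by (simp, intro mult_mono, simp_all)
  then have j: "integrable lborel01 (\<lambda>x. exp_density \<theta> x * g x)"
    by (intro integral_lborel01_bounds(1)) (use g(1) in auto)
  have "(LINT x|exp_measure \<theta>. g x) \<le> (LINT x|lborel01. exp (2 * sobolev_B p Q) * g x)"
    unfolding integral_exp_measure[OF assms(1,2) g(1)]
    by (intro integral_mono j integrable_mult_right i mult_right_mono d g)
  then show "(LINT x|exp_measure \<theta>. g x) \<le> exp (2 * sobolev_B p Q) * (LINT x|lborel01. g x)"
    by simp
  have "(LINT x|lborel01. exp (- 2 * sobolev_B p Q) * g x) \<le> (LINT x|exp_measure \<theta>. g x)"
    unfolding integral_exp_measure[OF assms(1,2) g(1)]
    by (intro integral_mono j integrable_mult_right i mult_right_mono d g)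
  then show "exp (- 2 * sobolev_B p Q) * (LINT x|lborel01. g x) \<le> (LINT x|exp_measure \<theta>. g x)"
    by simp
qed

section \<open>The Kullback--Leibler divergence\<close>

text \<open>Relative to \<open>P\<^sub>0\<close> the log-likelihood ratio of one observation splits into a centred part, linear in the
  parameter difference, and a deterministic drift. The drift is minus the Kullback--Leibler divergence
  of \<open>P\<^sub>0\<close> relative to \<open>P\<^sub>\<theta>\<close>, here written as the log-normaliser of the centred part.\<close>

definition centred_log_ratio :: "(nat \<Rightarrow> real) \<Rightarrow> (nat \<Rightarrow> real) \<Rightarrow> real \<Rightarrow> real" where
  "centred_log_ratio \<theta>0 \<theta> x =
     log_series \<theta> x - log_series \<theta>0 x
       - (LINT t|exp_measure \<theta>0. log_series \<theta> t - log_series \<theta>0 t)"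

definition exp_family_KL :: "(nat \<Rightarrow> real) \<Rightarrow> (nat \<Rightarrow> real) \<Rightarrow> real" where
  "exp_family_KL \<theta>0 \<theta> = ln (LINT x|exp_measure \<theta>0. exp (centred_log_ratio \<theta>0 \<theta> x))"

text \<open>The centred log ratio \<open>h - hb\<close> is bounded by \<open>4 * B\<close>, which is the source of the factors
  \<open>exp (4 * B)\<close> and \<open>exp (- 8 * B)\<close>; replacing \<open>P\<^sub>0\<close> by Lebesgue measure costs another
  \<open>exp (2 * B)\<close> in each direction. Over Lebesgue measure the second moment of \<open>h\<close> is the squared
  \<open>\<ell>\<^sub>2\<close>-distance of the parameters by Parseval's identity. Thus the divergence, and not only
  the Hellinger distance that it dominates, is equivalent to this distance.\<close>

lemma exp_family_KL_facts:
  fixes \<theta>0 \<theta> :: "nat \<Rightarrow> real"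
  assumes p: "p \<ge> 1" and \<theta>0: "\<theta>0 \<in> sobolev_ellipsoid p Q" and \<theta>: "\<theta> \<in> sobolev_ellipsoid p Q"
  defines "D \<equiv> (\<Sum>j. (\<theta> (Suc j) - \<theta>0 (Suc j))\<^sup>2)" and "B \<equiv> sobolev_B p Q"
  shows "exp_density \<theta> x = exp_density \<theta>0 x * exp (centred_log_ratio \<theta>0 \<theta> x - exp_family_KL \<theta>0 \<theta>)"
    and "(hellinger_dist (exp_density \<theta>0) (exp_density \<theta>))\<^sup>2 \<le> exp_family_KL \<theta>0 \<theta>"
    and "exp_family_KL \<theta>0 \<theta> \<le> exp (6 * B) / 2 * D"
    and "exp (- 10 * B) / 2 * D \<le> exp_family_KL \<theta>0 \<theta>"
    and "centred_log_ratio \<theta>0 \<theta> x =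
      (\<Sum>j. (\<theta> (Suc j) - \<theta>0 (Suc j)) *
        (trig_basis (Suc j) x - (LINT t|exp_measure \<theta>0. trig_basis (Suc j) t)))"
    and "summable (\<lambda>j. (\<theta> (Suc j) - \<theta>0 (Suc j)) *
        (trig_basis (Suc j) x - (LINT t|exp_measure \<theta>0. trig_basis (Suc j) t)))"
proof -
  interpret P0: prob_space "exp_measure \<theta>0" by (rule prob_space_exp_measure[OF p \<theta>0])
  interpret lb: prob_space lborel01 by (rule prob_space_lborel01)
  define \<delta> where "\<delta> j = \<theta> (Suc j) - \<theta>0 (Suc j)" for j
  \<comment> \<open>the log ratio of the unnormalised densities\<close>
  define h where "h = trig_series \<delta>"
  define hb where "hb = (LINT t|exp_measure \<theta>0. h t)"
  note as = sobolev_ellipsoid_absolutely_summable(1)[OF p \<theta>] sobolev_ellipsoid_absolutely_summable(1)[OF p \<theta>0]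
  have \<delta>s: "summable (\<lambda>j. \<bar>\<delta> j\<bar>)"
    by (rule summable_comparison_test'[OF summable_add[OF as], of 0]) (auto simp: \<delta>_def)
  have h_eq: "h x = log_series \<theta> x - log_series \<theta>0 x" for x
    unfolding h_def log_series_eq_trig_series trig_series_def \<delta>_def
    by (subst suminf_diff[OF trig_series_summable(2)[OF as(1)] trig_series_summable(2)[OF as(2)]])
       (simp add: left_diff_distrib)
  have h_meas [measurable]: "h \<in> borel_measurable borel" by (simp add: h_def)
  have hB: "\<bar>h x\<bar> \<le> 2 * B" for x
    using log_series_bound[OF p \<theta>, of x] log_series_bound[OF p \<theta>0, of x] by (simp add: h_eq B_def)
  have h_int0: "integrable (exp_measure \<theta>0) h"
    by (rule P0.integrable_const_bound[where B = "2 * B"])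
       (use hB in \<open>auto intro!: borel_measurable_exp_measure borel_measurable_lborel01\<close>)
  have hbB: "\<bar>hb\<bar> \<le> 2 * B"
    using P0.integral_ge_const[OF h_int0, of "- (2 * B)"] P0.integral_le_const[OF h_int0, of "2 * B"] hB
    by (auto simp: hb_def abs_le_iff minus_le_iff)
  let ?g = "centred_log_ratio \<theta>0 \<theta>" and ?L = "exp_family_KL \<theta>0 \<theta>"
  have g_eq: "?g x = h x - hb" for x
    by (simp add: centred_log_ratio_def hb_def h_eq)
  have g_meas [measurable]: "?g \<in> borel_measurable borel"
    unfolding g_eq[abs_def] by measurable
  have gB: "\<bar>?g x\<bar> \<le> 4 * B" for x using hB[of x] hbB by (simp add: g_eq)
  have gmean: "(LINT x|exp_measure \<theta>0. ?g x) = 0"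
    unfolding g_eq using h_int0 by (simp add: hb_def P0.prob_space)
  note LN = P0.log_normaliser_bounds[OF borel_measurable_exp_measure[OF g_meas] gB gmean, folded exp_family_KL_def, simplified]
  have D: "(LINT x|lborel01. (h x)\<^sup>2) = D" "(LINT x|lborel01. h x) = 0"
    using Parseval_trig_series[OF \<delta>s] unfolding h_def D_def \<delta>_def[symmetric] by auto
  have sq: "(y::real)\<^sup>2 \<le> c\<^sup>2" if "\<bar>y\<bar> \<le> c" for y c
    using that by (metis abs_ge_zero order_trans power2_abs power_mono)
  have h2: "(h x)\<^sup>2 \<le> (2 * B)\<^sup>2" "(?g x)\<^sup>2 \<le> (4 * B)\<^sup>2" for x
    by (rule sq[OF hB], rule sq[OF gB])
  have ih: "integrable lborel01 h"
    by (rule lb.integrable_const_bound[where B = "2 * B"])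
       (use hB in \<open>auto intro!: borel_measurable_exp_measure borel_measurable_lborel01\<close>)
  have ih2: "integrable lborel01 (\<lambda>x. (h x)\<^sup>2)" "integrable (exp_measure \<theta>0) (\<lambda>x. (h x)\<^sup>2)"
    by (rule lb.integrable_const_bound[where B = "(2 * B)\<^sup>2"]; use h2(1) in \<open>simp add: borel_measurable_lborel01\<close>)
       (rule P0.integrable_const_bound[where B = "(2 * B)\<^sup>2"]; use h2(1) in \<open>simp add: borel_measurable_exp_measure\<close>)
  show dens: "exp_density \<theta> x = exp_density \<theta>0 x * exp (?g x - ?L)" for x
  proof -
    let ?Z = "\<lambda>\<theta>. LINT t|lborel01. exp (log_series \<theta> t)"
    have Z: "0 < ?Z \<theta>" "0 < ?Z \<theta>0" using exp_density_facts(1)[OF p] \<theta> \<theta>0 by auto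
    have key: "exp_density \<theta>0 x * exp (?g x) = exp (log_series \<theta> x) * (exp (- hb) / ?Z \<theta>0)" for x
    proof -
      have "exp (log_series \<theta>0 x) * exp (?g x) = exp (log_series \<theta> x) * exp (- hb)"
        by (simp add: g_eq h_eq exp_add[symmetric])
      then show ?thesis by (simp add: exp_density_def)
    qed
    have "exp ?L = (LINT x|exp_measure \<theta>0. exp (?g x))" by (rule LN(1))
    also have "\<dots> = (LINT x|lborel01. exp_density \<theta>0 x * exp (?g x))"
      by (rule integral_exp_measure[OF p \<theta>0]) measurable
    also have "\<dots> = ?Z \<theta> * (exp (- hb) / ?Z \<theta>0)" unfolding key by simp
    finally have L: "exp ?L = ?Z \<theta> * (exp (- hb) / ?Z \<theta>0)" .
    have "exp_density \<theta>0 x * exp (?g x - ?L) = exp (log_series \<theta> x) * (exp (- hb) / ?Z \<theta>0) / exp ?L"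
      unfolding exp_diff key[symmetric] by simp
    also have "\<dots> = exp_density \<theta> x"
      unfolding L exp_density_def using Z by simp
    finally show ?thesis by simp
  qed
  show "(hellinger_dist (exp_density \<theta>0) (exp_density \<theta>))\<^sup>2 \<le> ?L"
  proof -
    note d0 = exp_density_facts[OF p \<theta>0] and d = exp_density_facts[OF p \<theta>]
    let ?r = "\<lambda>x. exp ((?g x - ?L) / 2)"
    \<comment> \<open>the root of the density ratio turns the Hellinger affinity into an exponential moment under \<open>P\<^sub>0\<close>\<close>
    have root: "sqrt (exp_density \<theta> x) = sqrt (exp_density \<theta>0 x) * ?r x" for x
    proof -
      have "sqrt (exp (?g x - ?L)) = ?r x"
        by (rule real_sqrt_unique) (simp_all add: power2_eq_square exp_add[symmetric])
      then show ?thesis unfolding dens by (simp only: real_sqrt_mult)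
    qed
    have sq_diff: "(sqrt (exp_density \<theta>0 x) - sqrt (exp_density \<theta> x))\<^sup>2 =
        exp_density \<theta>0 x + exp_density \<theta> x - 2 * (exp_density \<theta>0 x * ?r x)" for x
    proof -
      have "sqrt (exp_density \<theta>0 x) * sqrt (exp_density \<theta> x) = exp_density \<theta>0 x * ?r x"
        unfolding root using d0(4)[of x] by (simp add: mult.assoc[symmetric])
      then show ?thesis
        using d0(4)[of x] d(4)[of x] by (simp add: power2_diff)
    qed
    have i: "integrable lborel01 (exp_density \<theta>0)" "integrable lborel01 (exp_density \<theta>)"
      by (rule integral_lborel01_bounds(1)[OF exp_density_measurable d0(2,3)]
            integral_lborel01_bounds(1)[OF exp_density_measurable d(2,3)])+
    have i2: "integrable lborel01 (\<lambda>x. exp_density \<theta>0 x * ?r x)"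
    proof (rule integral_lborel01_bounds(1))
      fix x
      have "?r x \<le> exp ((4 * B - ?L) / 2)" using gB[of x] by (simp add: abs_le_iff)
      then show "0 \<le> exp_density \<theta>0 x * ?r x" "exp_density \<theta>0 x * ?r x \<le> exp (2 * B) * exp ((4 * B - ?L) / 2)"
        using d0(3,4)[of x] by (auto intro!: mult_mono simp: less_imp_le B_def)
    qed measurable
    have "(LINT x|lborel01. (sqrt (exp_density \<theta>0 x) - sqrt (exp_density \<theta> x))\<^sup>2) =
        2 - 2 * (LINT x|lborel01. exp_density \<theta>0 x * ?r x)"
      unfolding sq_diff using i i2 by (simp add: d(5) d0(5))
    also have "(LINT x|lborel01. exp_density \<theta>0 x * ?r x) = (LINT x|exp_measure \<theta>0. ?r x)"
      by (rule integral_exp_measure[OF p \<theta>0, symmetric]) measurable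
    also have "2 - 2 * \<dots> \<le> ?L" by (rule LN(4))
    finally show ?thesis
      unfolding hellinger_dist_def by (simp add: integral_nonneg_AE)
  qed
  show "?L \<le> exp (6 * B) / 2 * D"
  proof -
    have "(LINT x|exp_measure \<theta>0. (?g x)\<^sup>2) = (LINT x|exp_measure \<theta>0. (h x)\<^sup>2) - hb\<^sup>2"
      unfolding g_eq hb_def by (rule P0.variance_eq[OF h_int0 ih2(2)])
    also have "\<dots> \<le> (LINT x|exp_measure \<theta>0. (h x)\<^sup>2)" by simp
    also have "\<dots> \<le> exp (2 * B) * D"
      unfolding D(1)[symmetric] B_def
      by (rule integral_exp_measure_compare(1)[OF p \<theta>0 _ _ h2(1)]) auto
    finally have "exp (4 * B) / 2 * (LINT x|exp_measure \<theta>0. (?g x)\<^sup>2) \<le> exp (4 * B) / 2 * (exp (2 * B) * D)"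
      by (intro mult_left_mono) auto
    also have "\<dots> = exp (6 * B) / 2 * D" by (simp add: exp_add[symmetric])
    finally show ?thesis using LN(2) by linarith
  qed
  show "exp (- 10 * B) / 2 * D \<le> ?L"
  proof -
    \<comment> \<open>\<open>h\<close> has Lebesgue mean zero, so centring at \<open>hb\<close> only increases the second moment\<close>
    have "(LINT x|lborel01. (?g x)\<^sup>2) = (LINT x|lborel01. (h x)\<^sup>2 + hb\<^sup>2 - 2 * hb * h x)"
      unfolding g_eq power2_diff by (simp add: mult_ac)
    also have "\<dots> = D + hb\<^sup>2"
      using ih ih2(1) D lb.prob_space by simp
    finally have "D \<le> (LINT x|lborel01. (?g x)\<^sup>2)" by simp
    then have "exp (- 2 * B) * D \<le> exp (- 2 * B) * (LINT x|lborel01. (?g x)\<^sup>2)"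
      by simp
    also have "\<dots> \<le> (LINT x|exp_measure \<theta>0. (?g x)\<^sup>2)"
      unfolding B_def
      by (rule integral_exp_measure_compare(2)[OF p \<theta>0 _ _ h2(2)]) auto
    finally have "exp (- 2 * (4 * B)) / 2 * (exp (- 2 * B) * D) \<le> exp (- 2 * (4 * B)) / 2 * (LINT x|exp_measure \<theta>0. (?g x)\<^sup>2)"
      by (intro mult_left_mono) auto
    also have "exp (- 2 * (4 * B)) / 2 * (exp (- 2 * B) * D) = exp (- 10 * B) / 2 * D" by (simp add: exp_add[symmetric])
    finally show ?thesis using LN(3) by simp
  qed
  have hb_series: "hb = (\<Sum>j. \<delta> j * (LINT t|exp_measure \<theta>0. trig_basis (Suc j) t))"
      "summable (\<lambda>j. \<delta> j * (LINT t|exp_measure \<theta>0. trig_basis (Suc j) t))"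
    using integral_trig_series[OF P0.finite_measure_axioms sets_exp_measure \<delta>s, of "\<lambda>_. 1" 1]
    by (simp_all add: hb_def h_def)
  note diff = trig_series_summable(2)[OF \<delta>s] hb_series(2)
  show "?g x = (\<Sum>j. (\<theta> (Suc j) - \<theta>0 (Suc j)) *
        (trig_basis (Suc j) x - (LINT t|exp_measure \<theta>0. trig_basis (Suc j) t)))"
    unfolding g_eq hb_series(1) h_def trig_series_def suminf_diff[OF diff]
    by (simp add: \<delta>_def right_diff_distrib)
  show "summable (\<lambda>j. (\<theta> (Suc j) - \<theta>0 (Suc j)) *
        (trig_basis (Suc j) x - (LINT t|exp_measure \<theta>0. trig_basis (Suc j) t)))"
    using summable_diff[OF diff] by (simp add: \<delta>_def right_diff_distrib)
qed

section \<open>Concentration of weighted empirical features\<close>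

definition energy :: "(nat \<Rightarrow> real) \<Rightarrow> (nat \<Rightarrow> real) \<Rightarrow> real" where
  "energy w s = (\<Sum>j. w j * (s j)\<^sup>2)"

definition feature_sum :: "(nat \<Rightarrow> 'a \<Rightarrow> real) \<Rightarrow> nat \<Rightarrow> (nat \<Rightarrow> 'a) \<Rightarrow> nat \<Rightarrow> real" where
  "feature_sum \<xi> n X j = (\<Sum>i<n. \<xi> j (X i))"

lemma summable_weighted_bounded_product:
  fixes s t :: "nat \<Rightarrow> real"
  assumes "summable w" "\<And>j. 0 \<le> w j" "\<And>j. \<bar>s j\<bar> \<le> c" "\<And>j. \<bar>t j\<bar> \<le> d"
  shows "summable (\<lambda>j. w j * (s j * t j))"
proof (rule summable_comparison_test'[where g = "\<lambda>j. w j * (c * d)" and N = 0])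
  show "summable (\<lambda>j. w j * (c * d))" by (intro summable_mult2 assms)
  have "0 \<le> c" using assms(3)[of 0] by linarith
  then show "norm (w j * (s j * t j)) \<le> w j * (c * d)" for j
    using assms(2-4)[of j] by (auto simp: abs_mult intro!: mult_left_mono mult_mono)
qed

text \<open>Independent observations of a random vector in a weighted \<open>\<ell>\<^sub>2\<close>-space. Two sizes of the vector
  enter separately: \<open>R\<close> bounds its squared norm, and \<open>v\<close> bounds the variance of its
  components in a fixed direction. In the application \<open>R\<close> grows like the dimension while \<open>v\<close> stays
  bounded. The squared norm of a sum of \<open>n\<close> copies has mean at most \<open>n * R\<close>. Because single directions
  are only weakly variable, exceeding a constant multiple of \<open>n * R\<close> has a probability
  exponentially small in \<open>R / v\<close>, as long as the square of \<open>R / v\<close> is small compared with \<open>n\<close>. An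
  inequality that knows \<open>R\<close> alone, such as bounded differences, gives only a constant probability.\<close>

locale weighted_features = prob_space P for P :: "'a measure" +
  fixes \<xi> :: "nat \<Rightarrow> 'a \<Rightarrow> real" and w :: "nat \<Rightarrow> real" and c R v :: real
  assumes feature_measurable [measurable]: "\<And>j. \<xi> j \<in> borel_measurable P"
    and weight_nonneg: "\<And>j. 0 \<le> w j" and weight_summable: "summable w"
    and feature_bound: "\<And>j x. \<bar>\<xi> j x\<bar> \<le> c"
    and energy_feature: "\<And>x. energy w (\<lambda>j. \<xi> j x) \<le> R" and R_pos: "0 < R"
    and linear_mean: "\<And>s C. (\<And>j. \<bar>s j\<bar> \<le> C) \<Longrightarrow> (LINT x|P. (\<Sum>j. w j * (s j * \<xi> j x))) = 0"
    and linear_variance: "\<And>s C. (\<And>j. \<bar>s j\<bar> \<le> C) \<Longrightarrow>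
      (LINT x|P. (\<Sum>j. w j * (s j * \<xi> j x))\<^sup>2) \<le> v * energy w s"
    and v_nonneg: "0 \<le> v"
begin

lemma energy_summable: "(\<And>j. \<bar>s j\<bar> \<le> C) \<Longrightarrow> summable (\<lambda>j. w j * (s j)\<^sup>2)"
  using summable_weighted_bounded_product[OF weight_summable weight_nonneg, of s C s C]
  by (simp add: power2_eq_square)

lemma energy_nonneg: "(\<And>j. \<bar>s j\<bar> \<le> C) \<Longrightarrow> 0 \<le> energy w s"
  unfolding energy_def by (intro suminf_nonneg energy_summable) (auto simp: weight_nonneg)

lemma energy_add:
  assumes s: "\<And>j. \<bar>s j\<bar> \<le> C"
  shows "energy w (\<lambda>j. s j + \<xi> j x) =
    energy w s + 2 * (\<Sum>j. w j * (s j * \<xi> j x)) + energy w (\<lambda>j. \<xi> j x)"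
proof -
  note sx = summable_weighted_bounded_product[OF weight_summable weight_nonneg s feature_bound[of _ x]]
  note ss = energy_summable[OF s] and xx = energy_summable[OF feature_bound[of _ x]]
  have "energy w (\<lambda>j. s j + \<xi> j x) =
      (\<Sum>j. (w j * (s j)\<^sup>2 + 2 * (w j * (s j * \<xi> j x))) + w j * (\<xi> j x)\<^sup>2)"
    unfolding energy_def by (intro suminf_cong) (simp add: power2_eq_square algebra_simps)
  also have "\<dots> = energy w s + 2 * (\<Sum>j. w j * (s j * \<xi> j x)) + energy w (\<lambda>j. \<xi> j x)"
    unfolding energy_def using ss sx xx
    by (simp only: suminf_add[symmetric] suminf_mult summable_add summable_mult)
  finally show ?thesis .
qed

lemma linear_bound:
  assumes s: "\<And>j. \<bar>s j\<bar> \<le> C"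
  shows "\<bar>\<Sum>j. w j * (s j * \<xi> j x)\<bar> \<le> sqrt (energy w s) * sqrt R"
proof -
  have w: "sqrt (w j) * sqrt (w j) = w j" for j by (simp add: weight_nonneg)
  have e: "w j * (s j * \<xi> j x) = (sqrt (w j) * s j) * (sqrt (w j) * \<xi> j x)" for j
    by (metis w mult.assoc mult.left_commute)
  have sq: "(sqrt (w j) * y)\<^sup>2 = w j * y\<^sup>2" for j y
    by (simp add: power_mult_distrib weight_nonneg)
  have "\<bar>\<Sum>j. w j * (s j * \<xi> j x)\<bar> \<le> sqrt (energy w s) * sqrt (energy w (\<lambda>j. \<xi> j x))"
    unfolding e energy_def
    using Cauchy_Schwarz_suminf(3)[of "\<lambda>j. sqrt (w j) * s j" "\<lambda>j. sqrt (w j) * \<xi> j x"]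
    by (simp only: sq energy_summable[OF s] energy_summable[OF feature_bound])
  also have "\<dots> \<le> sqrt (energy w s) * sqrt R"
    by (intro mult_left_mono real_sqrt_le_mono energy_feature real_sqrt_ge_zero energy_nonneg[OF s])
  finally show ?thesis .
qed

text \<open>One step of a Lyapunov recursion. Adding an observation changes \<open>a + energy w s\<close> by the relative
  amount \<open>y\<close>, which consists of a centred linear term and the squared norm of the observation.
  The condition on \<open>a\<close> keeps \<open>m * y\<close> in \<open>[-1, 1]\<close>, where the \<open>m\<close>-th power is a quadratic
  function of \<open>y\<close> up to constants: the linear term contributes through its variance, with \<open>m\<^sup>2 * v / a\<close>,
  and the squared norm through its size, with \<open>m * R / a\<close>.\<close>

lemma energy_power_step:
  fixes m :: nat
  assumes s: "\<And>j. \<bar>s j\<bar> \<le> C" and m: "1 \<le> m" and a: "4 * (real m)\<^sup>2 * R \<le> a"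
  shows "(\<integral>\<^sup>+x. ennreal ((a + energy w (\<lambda>j. s j + \<xi> j x)) ^ m) \<partial>P)
    \<le> ennreal ((a + energy w s) ^ m * (1 + 16 * real m * (R + real m * v) / a))"
proof -
  define q where "q = energy w s"
  define \<alpha> where "\<alpha> = sqrt (R / a)"
  define u where "u x = (\<Sum>j. w j * (s j * \<xi> j x))" for x
  define r where "r x = energy w (\<lambda>j. \<xi> j x)" for x
  have q0: "0 \<le> q" unfolding q_def by (rule energy_nonneg[OF s])
  have m1: "1 \<le> real m" using m by simp
  have a0: "0 < a"
  proof -
    have "0 < 4 * (real m)\<^sup>2 * R" using m1 R_pos by simp
    then show ?thesis using a by linarith
  qed
  have aq: "0 < a + q" using a0 q0 by linarith
  have \<alpha>0: "0 \<le> \<alpha>" using R_pos a0 by (simp add: \<alpha>_def)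
  have \<alpha>2: "\<alpha>\<^sup>2 = R / a" using R_pos a0 by (simp add: \<alpha>_def)
  have m\<alpha>: "2 * real m * \<alpha> \<le> 1"
  proof (rule power2_le_imp_le)
    show "(2 * real m * \<alpha>)\<^sup>2 \<le> 1\<^sup>2"
      using a a0 by (simp add: power_mult_distrib \<alpha>2 field_simps)
  qed simp
  have \<alpha>1: "\<alpha> \<le> 1"
    using m\<alpha> m1 \<alpha>0 by (smt (verit) mult_right_mono mult_cancel_right1)
  have [measurable]: "u \<in> borel_measurable P" "r \<in> borel_measurable P"
    unfolding u_def[abs_def] r_def[abs_def] energy_def by measurable
  have ub: "\<bar>u x\<bar> \<le> sqrt q * sqrt R" for x
    unfolding u_def q_def by (rule linear_bound[OF s])
  have rb: "0 \<le> r x" "r x \<le> R" for x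
    unfolding r_def using energy_nonneg[OF feature_bound] energy_feature by auto
  have iu: "integrable P u"
    by (rule integrable_const_bound[where B = "sqrt q * sqrt R"]) (use ub in auto)
  have iu2: "integrable P (\<lambda>x. (u x)\<^sup>2)"
    by (rule integrable_const_bound[where B = "(sqrt q * sqrt R)\<^sup>2"])
       (use ub in \<open>auto intro!: AE_I2 simp del: power_mult_distrib, metis abs_ge_zero power2_abs power_mono\<close>)
  let ?G = "\<lambda>x. 1 + (real m / (a + q)) * (2 * u x + R)
      + (2 * (real m)\<^sup>2 / (a + q)\<^sup>2) * (8 * (u x)\<^sup>2 + 2 * R\<^sup>2)"
  have point: "0 \<le> ?G x \<and> (a + energy w (\<lambda>j. s j + \<xi> j x)) ^ m \<le> (a + q) ^ m * ?G x" for x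
  proof -
    define y where "y = (2 * u x + r x) / (a + q)"
    have f: "a + energy w (\<lambda>j. s j + \<xi> j x) = (a + q) * (1 + y)"
      unfolding energy_add[OF s] using aq by (simp add: y_def q_def u_def r_def field_simps)
    have "0 \<le> energy w (\<lambda>j. s j + \<xi> j x)"
      by (rule energy_nonneg[OF order_trans[OF abs_triangle_ineq add_mono[OF s feature_bound]]])
    then have "0 \<le> (a + q) * (1 + y)" using f a0 by linarith
    then have y1: "0 \<le> 1 + y" using aq by (simp add: zero_le_mult_iff)
    \<comment> \<open>\<open>2 * sqrt q * sqrt a \<le> a + q\<close>: the offset \<open>a\<close> absorbs the linear term for every size of \<open>q\<close>\<close>
    have "\<bar>2 * u x\<bar> \<le> \<alpha> * (a + q)"
    proof -
      have "sqrt R = \<alpha> * sqrt a" using a0 by (simp add: \<alpha>_def real_sqrt_divide)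
      then have "\<bar>2 * u x\<bar> \<le> \<alpha> * (2 * (sqrt q * sqrt a))" using ub[of x] by (simp add: mult_ac)
      also have "2 * (sqrt q * sqrt a) \<le> a + q"
        using sum_squares_bound[of "sqrt q" "sqrt a"] q0 a0 by (simp add: mult_ac)
      finally show ?thesis using \<alpha>0 by (simp add: mult_left_mono)
    qed
    moreover have "\<bar>r x\<bar> \<le> \<alpha> * (a + q)"
    proof -
      have "r x \<le> R" by (rule rb)
      also have "R = \<alpha> * \<alpha> * a" using \<alpha>2 a0 by (simp add: power2_eq_square)
      also have "\<dots> \<le> \<alpha> * 1 * (a + q)"
        using \<alpha>0 \<alpha>1 a0 q0 by (intro mult_mono) auto
      finally show ?thesis using rb by simp
    qed
    ultimately have "\<bar>y\<bar> \<le> 2 * \<alpha>"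
      using aq unfolding y_def abs_divide by (simp add: pos_divide_le_eq)
    then have "real m * \<bar>y\<bar> \<le> real m * (2 * \<alpha>)" by (rule mult_left_mono) simp
    then have my: "\<bar>real m * y\<bar> \<le> 1" using m\<alpha> by (simp add: abs_mult mult_ac)
    have "(1 + y) ^ m \<le> exp y ^ m" by (rule power_mono[OF exp_ge_add_one_self y1])
    also have "\<dots> = exp (real m * y)" by (simp add: exp_of_nat_mult)
    also have "\<dots> \<le> 1 + real m * y + exp 1 / 2 * (real m * y)\<^sup>2"
      by (rule exp_quadratic_bounds(1)[OF my])
    also have "\<dots> \<le> 1 + real m * y + 2 * (real m * y)\<^sup>2"
      using exp_le by (intro add_left_mono mult_right_mono) auto
    also have "\<dots> = 1 + real m * y + 2 * (real m)\<^sup>2 * y\<^sup>2"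
      by (simp add: power_mult_distrib)
    also have "\<dots> \<le> ?G x"
    proof (intro add_mono order_refl)
      show "real m * y \<le> real m / (a + q) * (2 * u x + R)"
        using rb(2)[of x] aq by (simp add: y_def divide_right_mono mult_left_mono)
      have "(2 * u x + r x)\<^sup>2 \<le> 8 * (u x)\<^sup>2 + 2 * (r x)\<^sup>2"
        using sum_squares_bound[of "2 * u x" "r x"] by (simp add: power2_eq_square algebra_simps)
      also have "\<dots> \<le> 8 * (u x)\<^sup>2 + 2 * R\<^sup>2" using rb[of x] by (simp add: power_mono)
      finally have "2 * (real m)\<^sup>2 / (a + q)\<^sup>2 * (2 * u x + r x)\<^sup>2
          \<le> 2 * (real m)\<^sup>2 / (a + q)\<^sup>2 * (8 * (u x)\<^sup>2 + 2 * R\<^sup>2)"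
        by (intro mult_left_mono) auto
      then show "2 * (real m)\<^sup>2 * y\<^sup>2 \<le> 2 * (real m)\<^sup>2 / (a + q)\<^sup>2 * (8 * (u x)\<^sup>2 + 2 * R\<^sup>2)"
        by (simp add: y_def power_divide)
    qed
    finally have G: "(1 + y) ^ m \<le> ?G x" .
    have "0 \<le> ?G x" using G zero_le_power[OF y1, of m] by linarith
    moreover have "(a + energy w (\<lambda>j. s j + \<xi> j x)) ^ m \<le> (a + q) ^ m * ?G x"
      unfolding f power_mult_distrib by (rule mult_left_mono[OF G]) (use aq in simp)
    ultimately show ?thesis by blast
  qed
  have iG: "integrable P ?G" using iu iu2 by simp
  have "(\<integral>\<^sup>+x. ennreal ((a + energy w (\<lambda>j. s j + \<xi> j x)) ^ m) \<partial>P)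
      \<le> (\<integral>\<^sup>+x. ennreal ((a + q) ^ m * ?G x) \<partial>P)"
    by (intro nn_integral_mono ennreal_leI) (use point in blast)
  also have "\<dots> = ennreal (LINT x|P. (a + q) ^ m * ?G x)"
    by (rule nn_integral_eq_integral[OF integrable_mult_right[OF iG]])
       (use point aq in \<open>auto intro!: mult_nonneg_nonneg\<close>)
  also have "\<dots> \<le> ennreal ((a + q) ^ m * (1 + 16 * real m * (R + real m * v) / a))"
  proof (rule ennreal_leI)
    have mean: "(LINT x|P. u x) = 0" unfolding u_def by (rule linear_mean[OF s])
    let ?V = "LINT x|P. (u x)\<^sup>2"
    have var: "?V \<le> v * q" unfolding u_def q_def by (rule linear_variance[OF s])
    have V: "?V / (a + q)\<^sup>2 \<le> v / a"
    proof -
      have "?V * a \<le> (v * (a + q)) * (a + q)"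
      proof (rule mult_mono)
        show "?V \<le> v * (a + q)" using var v_nonneg a0 by (smt (verit) mult_left_mono)
      qed (use a0 q0 v_nonneg in auto)
      then show ?thesis using a0 aq by (simp add: divide_simps power2_eq_square mult_ac)
    qed
    have RR: "R\<^sup>2 / (a + q)\<^sup>2 * (4 * (real m)\<^sup>2) \<le> R / a"
    proof -
      have "R\<^sup>2 / (a + q)\<^sup>2 * (4 * (real m)\<^sup>2) \<le> R\<^sup>2 / a\<^sup>2 * (4 * (real m)\<^sup>2)"
        using a0 q0 by (intro mult_right_mono divide_left_mono power_mono) auto
      also have "\<dots> = R * (4 * (real m)\<^sup>2 * R) / a\<^sup>2" by (simp add: power2_eq_square)
      also have "\<dots> \<le> R * a / a\<^sup>2" using a R_pos by (intro divide_right_mono mult_left_mono) auto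
      also have "\<dots> = R / a" using a0 by (simp add: power2_eq_square)
      finally show ?thesis .
    qed
    have "(LINT x|P. ?G x) = 1 + real m / (a + q) * R
        + 2 * (real m)\<^sup>2 / (a + q)\<^sup>2 * (8 * ?V + 2 * R\<^sup>2)"
      using iu iu2 by (simp add: mean prob_space)
    also have "\<dots> = 1 + real m * R / (a + q) + 16 * (real m)\<^sup>2 * (?V / (a + q)\<^sup>2)
        + R\<^sup>2 / (a + q)\<^sup>2 * (4 * (real m)\<^sup>2)"
      by (simp add: add_divide_distrib algebra_simps)
    also have "\<dots> \<le> 1 + real m * R / a + 16 * (real m)\<^sup>2 * (v / a) + R / a"
      using q0 a0 R_pos by (intro add_mono order_refl V RR divide_left_mono mult_left_mono) auto
    also have "\<dots> = 1 + (real m * R + R + 16 * (real m * (real m * v))) / a"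
      by (simp add: add_divide_distrib power2_eq_square)
    also have "\<dots> \<le> 1 + 16 * real m * (R + real m * v) / a"
    proof -
      have "R \<le> real m * R" using m1 R_pos by simp
      then have "real m * R + R + 16 * (real m * (real m * v)) \<le> 16 * real m * (R + real m * v)"
        using R_pos by (simp add: algebra_simps)
      then show ?thesis using a0 by (simp add: divide_right_mono)
    qed
    finally have "(LINT x|P. ?G x) \<le> 1 + 16 * real m * (R + real m * v) / a" .
    then have "(a + q) ^ m * (LINT x|P. ?G x) \<le> (a + q) ^ m * (1 + 16 * real m * (R + real m * v) / a)"
      using aq by (intro mult_left_mono) auto
    then show "(LINT x|P. (a + q) ^ m * ?G x) \<le> (a + q) ^ m * (1 + 16 * real m * (R + real m * v) / a)"
      by (subst integral_mult_right_zero)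
  qed
  finally show ?thesis by (simp add: q_def)
qed

text \<open>Iteration of the step. The sum starts from an arbitrary vector \<open>s\<close>, so that the first observation
  can be split off and moved into the starting vector; the remaining ones are again an i.i.d. sequence.\<close>

lemma energy_power_moment:
  fixes m n :: nat
  assumes s: "\<And>j. \<bar>s j\<bar> \<le> C" and m: "1 \<le> m" and a: "4 * (real m)\<^sup>2 * R \<le> a"
  defines "\<kappa> \<equiv> 16 * real m * (R + real m * v) / a"
  shows "(\<integral>\<^sup>+X. ennreal ((a + energy w (\<lambda>j. s j + feature_sum \<xi> n X j)) ^ m) \<partial>(\<Pi>\<^sub>M i\<in>(UNIV :: nat set). P))
    \<le> ennreal ((a + energy w s) ^ m * (1 + \<kappa>) ^ n)"
  using s
proof (induction n arbitrary: s C)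
  interpret sequence_space P ..
  have a0: "0 \<le> a" using a R_pos by (smt (verit) mult_nonneg_nonneg zero_le_power2)
  then have \<kappa>0: "0 \<le> \<kappa>" using R_pos v_nonneg by (simp add: \<kappa>_def)
  {
    case 0
    then show ?case by (simp add: feature_sum_def P.emeasure_space_1)
  next
    case (Suc n)
    let ?F = "\<lambda>n s X. ennreal ((a + energy w (\<lambda>j. s j + feature_sum \<xi> n X j)) ^ m)"
    have F [measurable]: "?F n s \<in> borel_measurable S" for n s
      unfolding energy_def feature_sum_def by measurable
    have [measurable]: "(\<lambda>(x, X). case_nat x X) \<in> measurable (P \<Otimes>\<^sub>M S) S"
      by (auto intro!: measurable_case_nat' simp: split_beta')
    have shift: "?F (Suc n) s (case_nat x X) = ?F n (\<lambda>j. s j + \<xi> j x) X" for x X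
      by (simp add: feature_sum_def sum.lessThan_Suc_shift add.assoc del: sum.lessThan_Suc)
    have "(\<integral>\<^sup>+X. ?F (Suc n) s X \<partial>S) = (\<integral>\<^sup>+X. ?F (Suc n) s X \<partial>distr (P \<Otimes>\<^sub>M S) S (\<lambda>(x, X). case_nat x X))"
      by (simp only: PiM_iter)
    also have "\<dots> = (\<integral>\<^sup>+z. ?F (Suc n) s (case z of (x, X) \<Rightarrow> case_nat x X) \<partial>(P \<Otimes>\<^sub>M S))"
      by (rule nn_integral_distr) measurable
    also have "\<dots> = (\<integral>\<^sup>+x. (\<integral>\<^sup>+X. ?F (Suc n) s (case (x, X) of (x, X) \<Rightarrow> case_nat x X) \<partial>S) \<partial>P)"
      by (rule P.nn_integral_fst[symmetric]) measurable
    also have "\<dots> = (\<integral>\<^sup>+x. (\<integral>\<^sup>+X. ?F n (\<lambda>j. s j + \<xi> j x) X \<partial>S) \<partial>P)"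
      by (simp only: prod.case shift)
    also have "\<dots> \<le> (\<integral>\<^sup>+x. ennreal ((1 + \<kappa>) ^ n) * ennreal ((a + energy w (\<lambda>j. s j + \<xi> j x)) ^ m) \<partial>P)"
    proof (rule nn_integral_mono)
      fix x
      have b: "\<bar>s j + \<xi> j x\<bar> \<le> C + c" for j
        using Suc.prems[of j] feature_bound[of j x] by linarith
      show "(\<integral>\<^sup>+X. ?F n (\<lambda>j. s j + \<xi> j x) X \<partial>S)
          \<le> ennreal ((1 + \<kappa>) ^ n) * ennreal ((a + energy w (\<lambda>j. s j + \<xi> j x)) ^ m)"
        using Suc.IH[OF b] \<kappa>0 by (simp add: ennreal_mult'[symmetric] mult.commute)
    qed
    also have "\<dots> = ennreal ((1 + \<kappa>) ^ n) * (\<integral>\<^sup>+x. ennreal ((a + energy w (\<lambda>j. s j + \<xi> j x)) ^ m) \<partial>P)"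
      unfolding energy_def by (rule nn_integral_cmult) measurable
    also have "\<dots> \<le> ennreal ((1 + \<kappa>) ^ n) * ennreal ((a + energy w s) ^ m * (1 + \<kappa>))"
      unfolding \<kappa>_def by (intro mult_left_mono energy_power_step[OF Suc.prems m a]) auto
    also have "\<dots> = ennreal ((a + energy w s) ^ m * (1 + \<kappa>) ^ Suc n)"
      using \<kappa>0 by (simp add: ennreal_mult'[symmetric] mult_ac)
    finally show ?case .
  }
qed

text \<open>Markov's inequality for the \<open>m\<close>-th power with the offset \<open>a = n * (R + m * v)\<close>: each step then
  multiplies the moment by at most \<open>1 + 16 * m / n\<close>, all \<open>n\<close> steps by at most \<open>exp (16 * m)\<close>, and the
  threshold \<open>exp 17 * a\<close> beats this by \<open>exp (- m)\<close>. The order \<open>m\<close> may grow with \<open>n\<close>.\<close>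

lemma energy_tail:
  fixes m n :: nat
  assumes m: "1 \<le> m" and n: "4 * (real m)\<^sup>2 \<le> real n"
  defines "A \<equiv> {X \<in> space (\<Pi>\<^sub>M i\<in>(UNIV :: nat set). P).
      exp 17 * (real n * (R + real m * v)) \<le> energy w (feature_sum \<xi> n X)}"
  shows "A \<in> sets (\<Pi>\<^sub>M i\<in>(UNIV :: nat set). P)"
    and "measure (\<Pi>\<^sub>M i\<in>(UNIV :: nat set). P) A \<le> exp (- real m)"
proof -
  interpret sequence_space P ..
  define a where "a = real n * (R + real m * v)"
  have m1: "1 \<le> real m" using m by simp
  have n0: "0 < real n" using n m1 by (smt (verit) zero_less_power2 zero_less_mult_iff)
  have Rv: "0 < R + real m * v" using R_pos v_nonneg by (simp add: add_pos_nonneg)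
  have a0: "0 < a" using n0 Rv by (simp add: a_def)
  have "4 * (real m)\<^sup>2 * R \<le> real n * (R + real m * v)"
    using n R_pos v_nonneg by (intro mult_mono) auto
  then have a: "4 * (real m)\<^sup>2 * R \<le> a" by (simp add: a_def)
  have \<kappa>: "16 * real m * (R + real m * v) / a = 16 * real m / real n"
    using Rv by (simp add: a_def)
  let ?F = "\<lambda>X. ennreal ((a + energy w (feature_sum \<xi> n X)) ^ m)"
  have F [measurable]: "?F \<in> borel_measurable S" "(\<lambda>X. energy w (feature_sum \<xi> n X)) \<in> borel_measurable S"
    unfolding energy_def feature_sum_def by measurable
  show A: "A \<in> sets S" unfolding A_def by measurable
  have "(\<integral>\<^sup>+X. ?F X \<partial>S) \<le> ennreal (a ^ m * (1 + 16 * real m / real n) ^ n)"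
    using energy_power_moment[of "\<lambda>_. 0" 0 m a n] m a by (simp add: \<kappa> energy_def)
  also have "\<dots> \<le> ennreal (a ^ m * exp (16 * real m))"
  proof (intro ennreal_leI mult_left_mono)
    have "(1 + 16 * real m / real n) ^ n \<le> exp (16 * real m / real n) ^ n"
      by (intro power_mono exp_ge_add_one_self) auto
    also have "\<dots> = exp (16 * real m)" using n0 by (simp add: exp_of_nat_mult[symmetric])
    finally show "(1 + 16 * real m / real n) ^ n \<le> exp (16 * real m)" .
  qed (use a0 in simp)
  finally have mom: "(\<integral>\<^sup>+X. ?F X \<partial>S) \<le> ennreal (a ^ m * exp (16 * real m))" .
  have "emeasure S A \<le> emeasure S {X \<in> space S. 1 \<le> ennreal (1 / (exp 17 * a) ^ m) * ?F X}"
  proof (rule emeasure_mono)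
    show "A \<subseteq> {X \<in> space S. 1 \<le> ennreal (1 / (exp 17 * a) ^ m) * ?F X}"
    proof safe
      fix X assume X: "X \<in> A"
      then show "X \<in> space S" by (simp add: A_def)
      have "(exp 17 * a) ^ m \<le> (a + energy w (feature_sum \<xi> n X)) ^ m"
        using X a0 by (intro power_mono) (auto simp: A_def a_def)
      then have "1 \<le> 1 / (exp 17 * a) ^ m * (a + energy w (feature_sum \<xi> n X)) ^ m"
        using a0 by (simp add: pos_le_divide_eq)
      then show "1 \<le> ennreal (1 / (exp 17 * a) ^ m) * ?F X"
        using a0 by (simp add: ennreal_mult'[symmetric])
    qed
  qed measurable
  also have "\<dots> \<le> ennreal (1 / (exp 17 * a) ^ m) * (\<integral>\<^sup>+X. ?F X * indicator (space S) X \<partial>S)"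
    using nn_integral_Markov_inequality[of ?F "space S" S "ennreal (1 / (exp 17 * a) ^ m)"] by simp
  also have "(\<integral>\<^sup>+X. ?F X * indicator (space S) X \<partial>S) = (\<integral>\<^sup>+X. ?F X \<partial>S)"
    by (rule nn_integral_cong) simp
  also have "ennreal (1 / (exp 17 * a) ^ m) * \<dots> \<le> ennreal (1 / (exp 17 * a) ^ m) * ennreal (a ^ m * exp (16 * real m))"
    by (rule mult_left_mono[OF mom]) simp
  also have "\<dots> = ennreal (exp (- real m))"
  proof -
    have "exp 17 ^ m = exp (16 * real m) * exp (real m)"
      by (simp add: exp_of_nat_mult[symmetric] exp_add[symmetric])
    then have "1 / (exp 17 * a) ^ m * (a ^ m * exp (16 * real m)) = exp (- real m)"
      using a0 by (simp add: power_mult_distrib exp_minus field_simps)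
    then show ?thesis using a0 by (simp add: ennreal_mult'[symmetric])
  qed
  finally show "measure S A \<le> exp (- real m)"
    by (simp add: measure_def enn2real_leI)
qed

end

section \<open>Shrinkage weights at the rate\<close>

text \<open>The quantity \<open>n * \<epsilon>\<^sub>n\<^sup>2\<close>, which is, up to a constant, also the number of coefficients beyond which the
  tail of the ellipsoid is below the squared rate \<open>\<epsilon>\<^sub>n\<^sup>2\<close>.\<close>

definition effective_dimension :: "nat \<Rightarrow> nat \<Rightarrow> real" where
  "effective_dimension p n = real n powr (1 / (2 * real p + 1))"

lemma effective_dimension_at_top: "filterlim (effective_dimension p) at_top sequentially"
  unfolding effective_dimension_def by real_asymp

lemma rate_identities:
  assumes n: "0 < n" and e: "e = real n powr (- (real p / (2 * real p + 1)))"
  shows "e\<^sup>2 * effective_dimension p n ^ (2 * p) = 1"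
    and "real n * e\<^sup>2 = effective_dimension p n"
    and "effective_dimension p n ^ (2 * p + 1) = real n"
proof -
  have e2: "e\<^sup>2 = real n powr (- (2 * real p / (2 * real p + 1)))"
    using n by (simp add: e powr_power)
  have power: "effective_dimension p n ^ k = real n powr (real k / (2 * real p + 1))" for k
    using n by (simp add: effective_dimension_def powr_power)
  show "e\<^sup>2 * effective_dimension p n ^ (2 * p) = 1"
    unfolding e2 power using n by (simp add: powr_add[symmetric])
  have "real n * e\<^sup>2 = real n powr (1 + - (2 * real p / (2 * real p + 1)))"
    unfolding e2 powr_add using n by simp
  also have "1 + - (2 * real p / (2 * real p + 1)) = 1 / (2 * real p + 1)"
    by (simp add: field_simps)
  finally show "real n * e\<^sup>2 = effective_dimension p n" by (simp add: effective_dimension_def)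
  have "real (2 * p + 1) / (2 * real p + 1) = 1" by (simp add: divide_simps)
  then show "effective_dimension p n ^ (2 * p + 1) = real n"
    unfolding power using n by (simp only: powr_one of_nat_0_le_iff)
qed

text \<open>The inverse weight is \<open>1 + e\<^sup>2 * V\<close> with \<open>V\<close> the Sobolev weight. A difference \<open>\<delta>\<close> of two points of
  the ellipsoid therefore has dual energy at most its squared \<open>\<ell>\<^sub>2\<close>-norm plus \<open>4 * Q * e\<^sup>2\<close>: the
  smoothness of the parameters pays for the coefficients that the weights damp.\<close>

definition shrinkage :: "nat \<Rightarrow> real \<Rightarrow> nat \<Rightarrow> real" where
  "shrinkage p e j = 1 / (1 + e\<^sup>2 * sobolev_weight (Suc j) ^ (2 * p))"

lemma shrinkage_pos: "0 < shrinkage p e j" and shrinkage_le_1: "shrinkage p e j \<le> 1"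
proof -
  have "0 \<le> e\<^sup>2 * sobolev_weight (Suc j) ^ (2 * p)" by (simp add: power_mult)
  then show "0 < shrinkage p e j" "shrinkage p e j \<le> 1"
    unfolding shrinkage_def by (simp_all add: add_pos_nonneg)
qed

text \<open>The weights are of order one up to index \<open>N\<close> and decay at least quadratically afterwards, so their sum is of order \<open>N\<close>.
  With \<open>x = Suc j\<close> they are dominated by \<open>4 * N\<^sup>2 / ((N + x - 1) * (N + x))\<close>, which telescopes.\<close>

lemma shrinkage_sum:
  assumes p: "p \<ge> 1" and N: "1 \<le> N" and e: "e\<^sup>2 * N ^ (2 * p) = 1"
  shows "summable (shrinkage p e)" and "(\<Sum>j. shrinkage p e j) \<le> 4 * N"
proof -
  let ?f = "\<lambda>j. 1 / (N + real j)"
  let ?g = "\<lambda>j. 4 * N\<^sup>2 * (?f j - ?f (Suc j))"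
  have le: "shrinkage p e j \<le> ?g j" for j
  proof -
    define x where "x = real (Suc j)"
    have x: "1 \<le> x" by (simp add: x_def)
    define y where "y = x / N"
    have y0: "0 \<le> y" using x N by (simp add: y_def)
    have "y ^ (2 * p) = e\<^sup>2 * x ^ (2 * p)"
    proof -
      have "y ^ (2 * p) = (e\<^sup>2 * N ^ (2 * p)) * (x ^ (2 * p) / N ^ (2 * p))"
        by (simp add: e y_def power_divide)
      then show ?thesis using N by simp
    qed
    also have "\<dots> \<le> e\<^sup>2 * sobolev_weight (Suc j) ^ (2 * p)"
      using sobolev_weight_ge[of j] x by (intro mult_left_mono power_mono) (auto simp: x_def)
    finally have y1: "y ^ (2 * p) \<le> e\<^sup>2 * sobolev_weight (Suc j) ^ (2 * p)" .
    have "(1 + y\<^sup>2) / 2 \<le> 1 + y ^ (2 * p)"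
    proof (cases "y \<le> 1")
      case True
      then have "y\<^sup>2 \<le> 1" using y0 by (simp add: power_le_one)
      moreover have "0 \<le> y ^ (2 * p)" using y0 by simp
      ultimately show ?thesis unfolding add_divide_distrib by linarith
    next
      case False
      then have "y\<^sup>2 \<le> y ^ (2 * p)" using p by (intro power_increasing) auto
      moreover have "0 \<le> y\<^sup>2" by simp
      ultimately show ?thesis unfolding add_divide_distrib by linarith
    qed
    then have "(1 + y\<^sup>2) / 2 \<le> 1 + e\<^sup>2 * sobolev_weight (Suc j) ^ (2 * p)" using y1 by linarith
    moreover have "0 < (1 + y\<^sup>2) / 2" by (simp add: add_pos_nonneg)
    ultimately have "shrinkage p e j \<le> 1 / ((1 + y\<^sup>2) / 2)"
      unfolding shrinkage_def by (intro divide_left_mono) (auto intro!: mult_pos_pos elim: order_less_le_trans)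
    also have "\<dots> = 2 * N\<^sup>2 / (N\<^sup>2 + x\<^sup>2)"
      using N by (simp add: y_def power_divide divide_simps)
    also have "\<dots> \<le> 4 * N\<^sup>2 / ((N + x - 1) * (N + x))"
    proof -
      have "(N + x - 1) * (N + x) \<le> (N + x) * (N + x)"
        using N x by (intro mult_right_mono) auto
      also have "\<dots> \<le> 2 * (N\<^sup>2 + x\<^sup>2)"
        using sum_squares_bound[of N x] by (simp add: power2_eq_square algebra_simps)
      finally have "4 * N\<^sup>2 / (2 * (N\<^sup>2 + x\<^sup>2)) \<le> 4 * N\<^sup>2 / ((N + x - 1) * (N + x))"
        using N x by (intro divide_left_mono) (auto intro!: mult_pos_pos add_pos_pos)
      moreover have "4 * N\<^sup>2 / (2 * (N\<^sup>2 + x\<^sup>2)) = 2 * N\<^sup>2 / (N\<^sup>2 + x\<^sup>2)"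
        using mult_divide_mult_cancel_left[of 2 "2 * N\<^sup>2" "N\<^sup>2 + x\<^sup>2"] by simp
      ultimately show ?thesis by simp
    qed
    also have "\<dots> = ?g j"
    proof -
      have "1 / ((N + x - 1) * (N + x)) = 1 / (N + x - 1) - 1 / (N + x)"
        using N x by (simp add: field_simps)
      moreover have "N + x - 1 = N + real j" "N + x = N + real (Suc j)" by (simp_all add: x_def)
      ultimately show ?thesis by (metis (no_types, lifting) mult.right_neutral times_divide_eq_right)
    qed
    finally show ?thesis .
  qed
  have "?f \<longlonglongrightarrow> 0"
    by (rule tendsto_divide_0[OF tendsto_const])
       (rule filterlim_at_top_imp_at_infinity, rule filterlim_tendsto_add_at_top[OF tendsto_const filterlim_real_sequentially])
  from sums_mult[OF telescope_sums'[OF this], of "4 * N\<^sup>2"]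
  have g: "?g sums (4 * N\<^sup>2 * (1 / N))" by simp
  show s: "summable (shrinkage p e)"
    by (rule summable_comparison_test'[OF sums_summable[OF g], of 0])
       (use le shrinkage_pos[of p e] in \<open>auto simp: less_imp_le abs_of_pos\<close>)
  have "(\<Sum>j. shrinkage p e j) \<le> (\<Sum>j. ?g j)"
    by (rule suminf_le[OF le s sums_summable[OF g]])
  also have "\<dots> = 4 * N" using g N by (simp add: sums_unique[symmetric] power2_eq_square)
  finally show "(\<Sum>j. shrinkage p e j) \<le> 4 * N" .
qed

section \<open>The empirical trigonometric coefficients\<close>

definition centred_trig :: "(nat \<Rightarrow> real) \<Rightarrow> nat \<Rightarrow> real \<Rightarrow> real" where
  "centred_trig \<theta>0 j x = trig_basis (Suc j) x - (LINT t|exp_measure \<theta>0. trig_basis (Suc j) t)"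

lemma centred_trig_bound:
  assumes p: "p \<ge> 1" and \<theta>0: "\<theta>0 \<in> sobolev_ellipsoid p Q"
  shows "\<bar>centred_trig \<theta>0 j x\<bar> \<le> 2 * sqrt 2"
proof -
  interpret P0: prob_space "exp_measure \<theta>0" by (rule prob_space_exp_measure[OF p \<theta>0])
  have i: "integrable (exp_measure \<theta>0) (trig_basis (Suc j))"
    by (rule P0.integrable_const_bound[where B = "sqrt 2"])
       (simp_all add: trig_basis_bound borel_measurable_exp_measure)
  have t: "- sqrt 2 \<le> trig_basis (Suc j) t" "trig_basis (Suc j) t \<le> sqrt 2" for t
    using trig_basis_bound[of j t] by (auto simp: abs_le_iff)
  have "- sqrt 2 \<le> (LINT t|exp_measure \<theta>0. trig_basis (Suc j) t)"
    "(LINT t|exp_measure \<theta>0. trig_basis (Suc j) t) \<le> sqrt 2"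
    by (rule P0.integral_ge_const[OF i AE_I2[OF t(1)]]) (rule P0.integral_le_const[OF i AE_I2[OF t(2)]])
  then show ?thesis using t[of x] unfolding centred_trig_def by linarith
qed

lemma feature_sum_bound:
  assumes "\<And>x. \<bar>\<xi> j x\<bar> \<le> c"
  shows "\<bar>feature_sum \<xi> n X j\<bar> \<le> real n * c"
proof -
  have "\<bar>feature_sum \<xi> n X j\<bar> \<le> (\<Sum>i<n. \<bar>\<xi> j (X i)\<bar>)"
    unfolding feature_sum_def by (rule sum_abs)
  also have "\<dots> \<le> real (card {..<n}) * c"
    by (rule sum_bounded_above) (rule assms)
  finally show ?thesis by simp
qed

text \<open>The squared norm of a single feature vector is of the order of the sum of the weights, hence of \<open>N\<close>,
  whereas a linear combination has variance at most \<open>exp (2 * B)\<close> times its energy by Parseval's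
  identity and the upper bound on the density.\<close>

lemma centred_trig_weighted_features:
  assumes p: "p \<ge> 1" and \<theta>0: "\<theta>0 \<in> sobolev_ellipsoid p Q"
    and N: "1 \<le> N" and e: "e\<^sup>2 * N ^ (2 * p) = 1"
  shows "weighted_features (exp_measure \<theta>0) (centred_trig \<theta>0) (shrinkage p e) (2 * sqrt 2) (32 * N)
    (exp (2 * sobolev_B p Q))"
proof -
  interpret P0: prob_space "exp_measure \<theta>0" by (rule prob_space_exp_measure[OF p \<theta>0])
  let ?w = "shrinkage p e" and ?\<xi> = "centred_trig \<theta>0"
  have w0: "0 \<le> ?w j" for j using shrinkage_pos[of p e j] by simp
  note ws = shrinkage_sum[OF p N e]
  have bound: "\<bar>?\<xi> j x\<bar> \<le> 2 * sqrt 2" for j x by (rule centred_trig_bound[OF p \<theta>0])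
  have energy_le: "energy ?w (\<lambda>j. ?\<xi> j x) \<le> 32 * N" for x
  proof -
    have sq: "(?\<xi> j x)\<^sup>2 \<le> 8" for j
    proof -
      have "\<bar>?\<xi> j x\<bar>\<^sup>2 \<le> (2 * sqrt 2)\<^sup>2" by (rule power_mono[OF bound]) simp
      then show ?thesis by (simp add: power_mult_distrib)
    qed
    have "summable (\<lambda>j. ?w j * (?\<xi> j x)\<^sup>2)"
      using summable_weighted_bounded_product[OF ws(1) w0 bound[of _ x] bound[of _ x]] by (simp add: power2_eq_square)
    then have "energy ?w (\<lambda>j. ?\<xi> j x) \<le> (\<Sum>j. ?w j * 8)"
      unfolding energy_def by (intro suminf_le mult_left_mono sq w0 summable_mult2 ws(1))
    also have "\<dots> = (\<Sum>j. ?w j) * 8" by (rule suminf_mult2[OF ws(1), symmetric])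
    also have "\<dots> \<le> 32 * N" using ws(2) by simp
    finally show ?thesis .
  qed
  have linear: "(LINT x|exp_measure \<theta>0. (\<Sum>j. ?w j * (s j * ?\<xi> j x))) = 0 \<and>
      (LINT x|exp_measure \<theta>0. (\<Sum>j. ?w j * (s j * ?\<xi> j x))\<^sup>2) \<le> exp (2 * sobolev_B p Q) * energy ?w s"
    if s: "\<And>j. \<bar>s j\<bar> \<le> C" for s C
  proof -
    define b where "b j = ?w j * s j" for j
    have bs: "summable (\<lambda>j. \<bar>b j\<bar>)"
      by (rule summable_comparison_test'[OF summable_mult2[OF ws(1), of C], of 0])
         (simp add: b_def abs_mult w0 mult_left_mono s)
    let ?h = "trig_series b"
    define hb where "hb = (LINT x|exp_measure \<theta>0. ?h x)"
    have hb: "hb = (\<Sum>j. b j * (LINT t|exp_measure \<theta>0. trig_basis (Suc j) t))"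
      "summable (\<lambda>j. b j * (LINT t|exp_measure \<theta>0. trig_basis (Suc j) t))"
      using integral_trig_series[OF P0.finite_measure_axioms sets_exp_measure bs, of "\<lambda>_. 1" 1]
      by (simp_all add: hb_def)
    have eq: "(\<Sum>j. ?w j * (s j * ?\<xi> j x)) = ?h x - hb" for x
      unfolding hb(1) trig_series_def suminf_diff[OF trig_series_summable(2)[OF bs] hb(2)]
      by (simp add: b_def centred_trig_def right_diff_distrib mult.assoc)
    define c where "c = sqrt 2 * (\<Sum>j. \<bar>b j\<bar>)"
    have hc: "\<bar>?h x\<bar> \<le> c" for x unfolding c_def by (rule trig_series_bound[OF bs])
    have h2: "(?h x)\<^sup>2 \<le> c\<^sup>2" for x
      using power_mono[OF hc[of x], of 2] by simp
    have ih: "integrable (exp_measure \<theta>0) ?h"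
      by (rule P0.integrable_const_bound[where B = c]) (simp_all add: hc borel_measurable_exp_measure)
    have ih2: "integrable (exp_measure \<theta>0) (\<lambda>x. (?h x)\<^sup>2)"
      by (rule P0.integrable_const_bound[where B = "c\<^sup>2"]) (simp_all add: h2 borel_measurable_exp_measure)
    have "(LINT x|exp_measure \<theta>0. (?h x - hb)\<^sup>2) = (LINT x|exp_measure \<theta>0. (?h x)\<^sup>2) - hb\<^sup>2"
      unfolding hb_def by (rule P0.variance_eq[OF ih ih2])
    also have "\<dots> \<le> (LINT x|exp_measure \<theta>0. (?h x)\<^sup>2)" by simp
    also have "\<dots> \<le> exp (2 * sobolev_B p Q) * (LINT x|lborel01. (?h x)\<^sup>2)"
      by (rule integral_exp_measure_compare(1)[OF p \<theta>0 _ _ h2]) auto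
    also have "(LINT x|lborel01. (?h x)\<^sup>2) = (\<Sum>j. (b j)\<^sup>2)" by (rule Parseval_trig_series(1)[OF bs])
    also have "(\<Sum>j. (b j)\<^sup>2) \<le> energy ?w s"
    proof -
      have E: "summable (\<lambda>j. ?w j * (s j)\<^sup>2)"
        using summable_weighted_bounded_product[OF ws(1) w0 s s] by (simp add: power2_eq_square)
      have le: "(b j)\<^sup>2 \<le> ?w j * (s j)\<^sup>2" for j
      proof -
        have "(?w j)\<^sup>2 \<le> ?w j"
          using mult_left_mono[OF shrinkage_le_1[of p e j] w0[of j]] by (simp add: power2_eq_square)
        then show ?thesis by (simp add: b_def power_mult_distrib mult_right_mono)
      qed
      have "summable (\<lambda>j. (b j)\<^sup>2)"
        by (rule summable_comparison_test'[OF E, of 0]) (use le in simp)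
      then show ?thesis unfolding energy_def by (rule suminf_le[OF le _ E])
    qed
    finally have "(LINT x|exp_measure \<theta>0. (?h x - hb)\<^sup>2) \<le> exp (2 * sobolev_B p Q) * energy ?w s"
      by simp
    moreover have "(LINT x|exp_measure \<theta>0. ?h x - hb) = 0"
      using ih by (simp add: hb_def P0.prob_space)
    ultimately show ?thesis unfolding eq by blast
  qed
  have meas: "?\<xi> j \<in> borel_measurable (exp_measure \<theta>0)" for j
    unfolding centred_trig_def[abs_def] by (rule borel_measurable_exp_measure) measurable
  show ?thesis
    by unfold_locales (use meas w0 ws(1) bound energy_le linear N in \<open>simp_all, blast+\<close>)
qed

text \<open>The tail bound of order \<open>m\<close>, the effective dimension \<open>N\<close> rounded up, gives exceedance probabilities
  \<open>exp (- N)\<close>. They are summable because \<open>N\<close> is a positive power of \<open>n\<close>, and Borel--Cantelli applies.\<close>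

lemma empirical_energy_AE_bound:
  assumes p: "p \<ge> 1" and \<theta>0: "\<theta>0 \<in> sobolev_ellipsoid p Q"
    and \<epsilon>: "\<And>n. \<epsilon> n = real n powr (- (real p / (2 * real p + 1)))"
  shows "AE X in (\<Pi>\<^sub>M i\<in>(UNIV :: nat set). exp_measure \<theta>0). \<forall>\<^sub>F n in sequentially.
    energy (shrinkage p (\<epsilon> n)) (feature_sum (centred_trig \<theta>0) n X)
      \<le> exp 17 * (32 + 2 * exp (2 * sobolev_B p Q)) * (real n * \<epsilon> n)\<^sup>2"
proof -
  let ?S = "\<Pi>\<^sub>M i\<in>(UNIV :: nat set). exp_measure \<theta>0"
  interpret P0: prob_space "exp_measure \<theta>0" by (rule prob_space_exp_measure[OF p \<theta>0])
  interpret S: prob_space ?S by (rule prob_space_PiM) (rule P0.prob_space_axioms)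
  define K where "K = exp 17 * (32 + 2 * exp (2 * sobolev_B p Q))"
  define N where "N = effective_dimension p"
  \<comment> \<open>\<open>16 \<le> N\<close> and \<open>N ^ 3 \<le> N ^ (2 * p + 1) = n\<close> give the condition \<open>4 * m\<^sup>2 \<le> n\<close> of the tail bound\<close>
  define A where "A n = (if 16 \<le> N n then {X \<in> space ?S. K * (real n * \<epsilon> n)\<^sup>2 <
    energy (shrinkage p (\<epsilon> n)) (feature_sum (centred_trig \<theta>0) n X)} else {})" for n
  have N_top: "filterlim N at_top sequentially"
    unfolding N_def by (rule effective_dimension_at_top)
  note rate = rate_identities[OF _ \<epsilon>, folded N_def]
  have A: "A n \<in> sets ?S \<and> measure ?S (A n) \<le> exp (- N n)" for n
  proof (cases "16 \<le> N n")
    case True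
    then have n: "0 < n" by (cases n) (auto simp: N_def effective_dimension_def)
    note rate = rate[OF n]
    have N1: "1 \<le> N n" using True by simp
    interpret weighted_features "exp_measure \<theta>0" "centred_trig \<theta>0" "shrinkage p (\<epsilon> n)" "2 * sqrt 2" "32 * N n"
      "exp (2 * sobolev_B p Q)"
      by (rule centred_trig_weighted_features[OF p \<theta>0 N1 rate(1)])
    define m where "m = nat \<lceil>N n\<rceil>"
    have m: "1 \<le> m" "N n \<le> real m" "real m \<le> 2 * N n"
      using N1 by (auto simp: m_def le_nat_iff) linarith+
    have "4 * (real m)\<^sup>2 \<le> 4 * (2 * N n)\<^sup>2" using m by (intro mult_left_mono power_mono) auto
    also have "\<dots> = 16 * (N n)\<^sup>2" by (simp add: power_mult_distrib)
    also have "\<dots> \<le> N n * (N n)\<^sup>2" using True by (intro mult_right_mono) auto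
    also have "\<dots> = N n ^ 3" by (simp add: power3_eq_cube power2_eq_square)
    also have "\<dots> \<le> N n ^ (2 * p + 1)" using p N1 by (intro power_increasing) auto
    also have "\<dots> = real n" by (rule rate(3))
    finally have mn: "4 * (real m)\<^sup>2 \<le> real n" .
    note tail = energy_tail[OF m(1) mn]
    have K: "exp 17 * (real n * (32 * N n + real m * exp (2 * sobolev_B p Q))) \<le> K * (real n * \<epsilon> n)\<^sup>2"
    proof -
      have "real m * exp (2 * sobolev_B p Q) \<le> 2 * N n * exp (2 * sobolev_B p Q)"
        using m(3) by (intro mult_right_mono) auto
      then have "32 * N n + real m * exp (2 * sobolev_B p Q) \<le> (32 + 2 * exp (2 * sobolev_B p Q)) * N n"
        by (simp add: algebra_simps)
      then have "exp 17 * (real n * (32 * N n + real m * exp (2 * sobolev_B p Q))) \<le>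
          exp 17 * (real n * ((32 + 2 * exp (2 * sobolev_B p Q)) * N n))"
        by (intro mult_left_mono) auto
      also have "\<dots> = K * (real n * \<epsilon> n)\<^sup>2"
        unfolding K_def rate(2)[symmetric] by (simp add: power2_eq_square mult_ac)
      finally show ?thesis .
    qed
    have [measurable]: "(\<lambda>X. energy (shrinkage p (\<epsilon> n)) (feature_sum (centred_trig \<theta>0) n X)) \<in> borel_measurable ?S"
      unfolding energy_def feature_sum_def by measurable
    have sets: "A n \<in> sets ?S" unfolding A_def using True by simp
    have "measure ?S (A n) \<le> exp (- real m)"
      by (rule order_trans[OF S.finite_measure_mono[OF _ tail(1)] tail(2)])
         (use K True in \<open>auto simp: A_def\<close>)
    also have "\<dots> \<le> exp (- N n)" using m(2) by simp
    finally show ?thesis using sets by simp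
  next
    case False
    then show ?thesis by (simp add: A_def)
  qed
  have summ: "summable (\<lambda>n. measure ?S (A n))"
  proof (rule summable_comparison_test')
    define k where "k = (2 * p + 1) * 2"
    show "summable (\<lambda>n. fact k * inverse ((real n)\<^sup>2))"
      using inverse_power_summable[of 2, where 'a = real] by (intro summable_mult) simp
    fix n :: nat assume n: "n \<ge> 1"
    have Nn: "0 < N n" using n by (simp add: N_def effective_dimension_def)
    have "N n ^ k / fact k \<le> exp (N n)"
    proof -
      have "(\<Sum>i\<in>{k}. N n ^ i /\<^sub>R fact i) \<le> exp (N n)"
        unfolding exp_def by (rule sum_le_suminf[OF summable_exp_generic]) (use Nn in auto)
      then show ?thesis by (simp add: divide_inverse mult.commute)
    qed
    moreover have "N n ^ k = (real n)\<^sup>2"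
      unfolding k_def power_mult[of _ "2 * p + 1"] using rate(3)[of n] n by simp
    ultimately have "inverse (exp (N n)) \<le> inverse ((real n)\<^sup>2 / fact k)"
      using n by (intro le_imp_inverse_le) auto
    then have "exp (- N n) \<le> fact k * inverse ((real n)\<^sup>2)"
      by (simp add: exp_minus divide_inverse mult.commute)
    then show "norm (measure ?S (A n)) \<le> fact k * inverse ((real n)\<^sup>2)"
      using A[of n] by simp
  qed
  have "AE X in ?S. \<forall>\<^sub>F n in sequentially. X \<in> space ?S - A n"
    by (rule borel_cantelli_AE1) (use A summ in \<open>auto simp: S.emeasure_eq_measure\<close>)
  then show ?thesis
  proof (rule AE_mp, intro AE_I2 impI)
    fix X assume X: "\<forall>\<^sub>F n in sequentially. X \<in> space ?S - A n"
    have "\<forall>\<^sub>F n in sequentially. 16 \<le> N n"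
      using N_top by (simp add: filterlim_at_top)
    with X show "\<forall>\<^sub>F n in sequentially. energy (shrinkage p (\<epsilon> n)) (feature_sum (centred_trig \<theta>0) n X)
      \<le> exp 17 * (32 + 2 * exp (2 * sobolev_B p Q)) * (real n * \<epsilon> n)\<^sup>2"
      by eventually_elim (auto simp: A_def K_def not_less)
  qed
qed

section \<open>Likelihood ratios and the posterior\<close>

lemma likelihood_exp_family:
  assumes p: "p \<ge> 1" and \<theta>0: "\<theta>0 \<in> sobolev_ellipsoid p Q" and \<theta>: "\<theta> \<in> sobolev_ellipsoid p Q"
  shows "likelihood n X \<theta> = likelihood n X \<theta>0 *
    exp ((\<Sum>i<n. centred_log_ratio \<theta>0 \<theta> (X i)) - real n * exp_family_KL \<theta>0 \<theta>)"
proof -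
  have "likelihood n X \<theta> =
      (\<Prod>i<n. exp_density \<theta>0 (X i) * exp (centred_log_ratio \<theta>0 \<theta> (X i) - exp_family_KL \<theta>0 \<theta>))"
    unfolding likelihood_def by (intro prod.cong refl exp_family_KL_facts(1)[OF assms])
  then show ?thesis
    by (simp add: likelihood_def prod.distrib exp_sum[symmetric] sum_subtractf)
qed

text \<open>The sum of the centred log ratios is the inner product of \<open>\<theta> - \<theta>0\<close> with the empirical coefficients.
  Cauchy--Schwarz in the shrunken norm bounds it, for all \<open>\<theta>\<close> at once, by
  \<open>n * e * sqrt (K * (D + 4 * Q * e\<^sup>2))\<close>, and the arithmetic-geometric mean inequality with weight \<open>c\<close>
  absorbs \<open>D\<close> into half of the divergence, leaving a remainder of order \<open>n * e\<^sup>2\<close>.\<close>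

lemma linear_statistic_bound:
  assumes p: "p \<ge> 1" and \<theta>0: "\<theta>0 \<in> sobolev_ellipsoid p Q" and \<theta>: "\<theta> \<in> sobolev_ellipsoid p Q"
    and w: "summable (shrinkage p e)"
    and energy: "energy (shrinkage p e) (feature_sum (centred_trig \<theta>0) n X) \<le> K * (real n * e)\<^sup>2"
    and bounded: "\<And>j. \<bar>feature_sum (centred_trig \<theta>0) n X j\<bar> \<le> C"
  defines "c \<equiv> exp (- 10 * sobolev_B p Q) / 2"
  shows "\<bar>\<Sum>i<n. centred_log_ratio \<theta>0 \<theta> (X i)\<bar>
    \<le> real n * (exp_family_KL \<theta>0 \<theta> / 2 + (2 * Q * c + K / (2 * c)) * e\<^sup>2)"
proof -
  let ?w = "shrinkage p e" and ?S = "feature_sum (centred_trig \<theta>0) n X"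
  let ?L = "exp_family_KL \<theta>0 \<theta>"
  define \<delta> where "\<delta> j = \<theta> (Suc j) - \<theta>0 (Suc j)" for j
  define V where "V j = sobolev_weight (Suc j) ^ (2 * p)" for j
  define D where "D = (\<Sum>j. (\<delta> j)\<^sup>2)"
  have V0: "0 \<le> V j" for j by (simp add: V_def power_mult)
  have c0: "0 < c" by (simp add: c_def)
  have linear: "(\<Sum>i<n. centred_log_ratio \<theta>0 \<theta> (X i)) = (\<Sum>j. \<delta> j * ?S j)"
  proof -
    have "(\<Sum>i<n. centred_log_ratio \<theta>0 \<theta> (X i)) = (\<Sum>i<n. \<Sum>j. \<delta> j * centred_trig \<theta>0 j (X i))"
      unfolding \<delta>_def centred_trig_def by (intro sum.cong refl exp_family_KL_facts(5)[OF p \<theta>0 \<theta>])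
    also have "\<dots> = (\<Sum>j. \<Sum>i<n. \<delta> j * centred_trig \<theta>0 j (X i))"
      unfolding \<delta>_def centred_trig_def
      by (rule suminf_sum[symmetric]) (rule exp_family_KL_facts(6)[OF p \<theta>0 \<theta>])
    finally show ?thesis by (simp add: feature_sum_def sum_distrib_left)
  qed
  note t = sobolev_ellipsoid_tail[OF p \<theta>, folded V_def] sobolev_ellipsoid_tail[OF p \<theta>0, folded V_def]
  have sq: "(\<delta> j)\<^sup>2 \<le> 2 * (\<theta> (Suc j))\<^sup>2 + 2 * (\<theta>0 (Suc j))\<^sup>2" for j
    using sum_squares_bound[of "\<theta> (Suc j)" "- \<theta>0 (Suc j)"] by (simp add: \<delta>_def power2_diff)
  have sV: "V j * (\<delta> j)\<^sup>2 \<le> 2 * (V j * (\<theta> (Suc j))\<^sup>2) + 2 * (V j * (\<theta>0 (Suc j))\<^sup>2)" for j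
    using mult_left_mono[OF sq V0] by (simp add: algebra_simps)
  have D_sum: "summable (\<lambda>j. (\<delta> j)\<^sup>2)"
    by (rule summable_comparison_test'[OF summable_add[OF summable_mult[OF t(3), of 2] summable_mult[OF t(6), of 2]], of 0])
       (use sq in simp)
  note V_bd = summable_add[OF summable_mult[OF t(1), of 2] summable_mult[OF t(4), of 2]]
  have V_sum: "summable (\<lambda>j. V j * (\<delta> j)\<^sup>2)"
    by (rule summable_comparison_test'[OF V_bd, of 0]) (use sV V0 in simp)
  have V_le: "(\<Sum>j. V j * (\<delta> j)\<^sup>2) \<le> 4 * Q"
  proof -
    have "(\<Sum>j. V j * (\<delta> j)\<^sup>2) \<le> (\<Sum>j. 2 * (V j * (\<theta> (Suc j))\<^sup>2) + 2 * (V j * (\<theta>0 (Suc j))\<^sup>2))"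
      by (rule suminf_le[OF sV V_sum V_bd])
    also have "\<dots> = 2 * (\<Sum>j. V j * (\<theta> (Suc j))\<^sup>2) + 2 * (\<Sum>j. V j * (\<theta>0 (Suc j))\<^sup>2)"
      by (subst suminf_add[symmetric]) (simp_all add: t(1,4) suminf_mult summable_mult)
    finally show ?thesis using t(2,5) by linarith
  qed
  define a where "a j = \<delta> j / sqrt (?w j)" for j
  define b where "b j = sqrt (?w j) * ?S j" for j
  have w0: "0 < ?w j" for j by (rule shrinkage_pos)
  have ab: "a j * b j = \<delta> j * ?S j" for j
    using w0[of j] by (simp add: a_def b_def)
  have a2: "(a j)\<^sup>2 = (\<delta> j)\<^sup>2 + e\<^sup>2 * (V j * (\<delta> j)\<^sup>2)" for j
    using w0[of j] by (simp add: a_def power_divide shrinkage_def V_def algebra_simps)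
  have b2: "(b j)\<^sup>2 = ?w j * (?S j)\<^sup>2" for j
    using w0[of j] by (simp add: b_def power_mult_distrib)
  have a_sum: "summable (\<lambda>j. (a j)\<^sup>2)"
    unfolding a2 by (intro summable_add D_sum summable_mult V_sum)
  have a_le: "(\<Sum>j. (a j)\<^sup>2) \<le> D + 4 * Q * e\<^sup>2"
  proof -
    have "(\<Sum>j. (a j)\<^sup>2) = D + e\<^sup>2 * (\<Sum>j. V j * (\<delta> j)\<^sup>2)"
      unfolding a2 D_def
      by (subst suminf_add[symmetric]) (simp_all add: D_sum V_sum summable_mult suminf_mult)
    also have "\<dots> \<le> D + e\<^sup>2 * (4 * Q)" by (intro add_left_mono mult_left_mono V_le) simp
    finally show ?thesis by (simp add: mult_ac)
  qed
  then have a_nonneg: "0 \<le> D + 4 * Q * e\<^sup>2"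
    using suminf_nonneg[OF a_sum] by simp
  have b_sum: "summable (\<lambda>j. (b j)\<^sup>2)"
    unfolding b2 using summable_weighted_bounded_product[OF w less_imp_le[OF w0] bounded bounded]
    by (simp add: power2_eq_square)
  have "\<bar>\<Sum>j. \<delta> j * ?S j\<bar> \<le> sqrt (\<Sum>j. (a j)\<^sup>2) * sqrt (\<Sum>j. (b j)\<^sup>2)"
    using Cauchy_Schwarz_suminf(3)[OF a_sum b_sum] by (simp only: ab)
  also have "\<dots> \<le> sqrt (D + 4 * Q * e\<^sup>2) * sqrt (K * (real n * e)\<^sup>2)"
    using a_le a_nonneg energy unfolding b2 energy_def
    by (intro mult_mono real_sqrt_le_mono) (auto intro!: suminf_nonneg b_sum[unfolded b2] mult_nonneg_nonneg less_imp_le[OF w0])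
  also have "\<dots> \<le> real n * (?L / 2 + (2 * Q * c + K / (2 * c)) * e\<^sup>2)"
  proof -
    define Y where "Y = D + 4 * Q * e\<^sup>2"
    define Z where "Z = K * e\<^sup>2"
    have Y0: "0 \<le> Y"
      using a_nonneg by (simp add: Y_def)
    show ?thesis
    proof (cases "n = 0")
      case False
      have "0 \<le> K * (real n * e)\<^sup>2"
      proof -
        have "0 \<le> energy ?w ?S"
          unfolding energy_def b2[symmetric] by (rule suminf_nonneg[OF b_sum]) simp
        then show ?thesis using energy by linarith
      qed
      then have "0 \<le> (real n)\<^sup>2 * Z" by (simp add: Z_def power_mult_distrib mult_ac)
      then have Z0: "0 \<le> Z" using False by (simp add: zero_le_mult_iff)
      have "sqrt (K * (real n * e)\<^sup>2) = real n * sqrt Z"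
        by (simp add: Z_def power_mult_distrib real_sqrt_mult)
      then have factor: "sqrt (D + 4 * Q * e\<^sup>2) * sqrt (K * (real n * e)\<^sup>2) = real n * (sqrt Y * sqrt Z)"
        by (simp add: Y_def)
      have amgm: "sqrt Y * sqrt Z \<le> c / 2 * Y + Z / (2 * c)"
      proof -
        have "2 * (sqrt (c * Y) * sqrt (Z / c)) \<le> c * Y + Z / c"
          using sum_squares_bound[of "sqrt (c * Y)" "sqrt (Z / c)"] c0 Y0 Z0 by (simp add: mult_ac)
        moreover have "sqrt (c * Y) * sqrt (Z / c) = sqrt Y * sqrt Z"
          using c0 by (simp add: real_sqrt_mult real_sqrt_divide)
        ultimately show ?thesis by (simp add: field_simps)
      qed
      have KL: "c / 2 * Y + Z / (2 * c) \<le> ?L / 2 + (2 * Q * c + K / (2 * c)) * e\<^sup>2"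
      proof -
        have "c * D \<le> ?L"
          using exp_family_KL_facts(4)[OF p \<theta>0 \<theta>] by (simp add: c_def D_def \<delta>_def)
        then show ?thesis by (simp add: Y_def Z_def algebra_simps)
      qed
      show ?thesis
        unfolding factor by (rule mult_left_mono[OF order_trans[OF amgm KL]]) simp
    qed simp
  qed
  finally show ?thesis by (simp only: linear)
qed

text \<open>The posterior is taken over a set of measures, which determine their densities only almost everywhere;
  the Hellinger distance does not see the difference.\<close>

lemma hellinger_dist_exp_measure_eq:
  assumes "p \<ge> 1" "\<theta> \<in> sobolev_ellipsoid p Q" "\<theta>' \<in> sobolev_ellipsoid p Q"
    and eq: "exp_measure \<theta> = exp_measure \<theta>'" and f: "f \<in> borel_measurable borel"
  shows "hellinger_dist f (exp_density \<theta>) = hellinger_dist f (exp_density \<theta>')"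
proof -
  interpret prob_space lborel01 by (rule prob_space_lborel01)
  note [measurable] = f
  have m: "(\<lambda>x. ennreal (exp_density \<theta> x)) \<in> borel_measurable lborel01" for \<theta>
    by (intro measurable_compose[OF _ measurable_ennreal] borel_measurable_lborel01) simp
  have "AE x in lborel01. ennreal (exp_density \<theta> x) = ennreal (exp_density \<theta>' x)"
    by (rule density_unique[OF m m]) (use eq in \<open>simp add: exp_measure_def\<close>)
  then have "AE x in lborel01. exp_density \<theta> x = exp_density \<theta>' x"
    by eventually_elim (use exp_density_facts(4)[OF assms(1,2)] exp_density_facts(4)[OF assms(1,3)] in \<open>simp add: less_imp_le\<close>)
  then have "(LINT x|lborel01. (sqrt (f x) - sqrt (exp_density \<theta> x))\<^sup>2) =
      (LINT x|lborel01. (sqrt (f x) - sqrt (exp_density \<theta>' x))\<^sup>2)"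
    by (intro integral_cong_AE borel_measurable_lborel01) (auto elim!: eventually_mono)
  then show ?thesis by (simp add: hellinger_dist_def)
qed

lemma space_prior_on_ellipsoid:
  assumes "prior_on_ellipsoid p Q \<mu>"
  shows "space \<mu> = sobolev_ellipsoid p Q"
proof -
  have "space \<mu> = space (restrict_space (\<Pi>\<^sub>M j\<in>UNIV. borel) (sobolev_ellipsoid p Q))"
    by (rule sets_eq_imp_space_eq) (use assms in \<open>simp add: prior_on_ellipsoid_def\<close>)
  then show ?thesis by (simp add: space_restrict_space space_PiM)
qed

text \<open>Up to the common factor \<open>likelihood n X \<theta>0\<close>, the hypothesis \<open>linear\<close> confines every log-likelihood to
  within \<open>n * (KL / 2 + C1 * e\<^sup>2)\<close> of \<open>- n * KL\<close>. At Hellinger distance above \<open>M * e\<close> the divergence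
  exceeds \<open>M\<^sup>2 * e\<^sup>2\<close>, which makes the numerator small; in the ball charged by the prior it is at most
  \<open>C2 * e\<^sup>2\<close>, which keeps the denominator large.\<close>

lemma posterior_bound:
  assumes p: "p \<ge> 1" and \<theta>0: "\<theta>0 \<in> sobolev_ellipsoid p Q" and prior: "prior_on_ellipsoid p Q \<mu>"
    and linear: "\<And>\<theta>. \<theta> \<in> sobolev_ellipsoid p Q \<Longrightarrow>
      \<bar>\<Sum>i<n. centred_log_ratio \<theta>0 \<theta> (X i)\<bar> \<le> real n * (exp_family_KL \<theta>0 \<theta> / 2 + C1 * e\<^sup>2)"
    and mass: "measure \<mu> {\<theta> \<in> sobolev_ellipsoid p Q. (\<Sum>j. (\<theta> (Suc j) - \<theta>0 (Suc j))\<^sup>2) \<le> r * e\<^sup>2} \<ge> \<beta>"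
    and \<beta>: "0 < \<beta>" and r: "r \<le> 1" and M: "0 \<le> M * e"
  defines "C2 \<equiv> exp (6 * sobolev_B p Q) / 2"
  defines "post \<equiv> posterior \<mu> n X {exp_measure \<theta> | \<theta>. \<theta> \<in> sobolev_ellipsoid p Q \<and>
                   hellinger_dist (exp_density \<theta>0) (exp_density \<theta>) > M * e}"
  shows "0 \<le> post" "post \<le> exp (- (real n * e\<^sup>2 * (M\<^sup>2 / 2 - 2 * C1 - 3 / 2 * C2))) / \<beta>"
proof -
  interpret prob_space \<mu> using prior by (simp add: prior_on_ellipsoid_def)
  note space = space_prior_on_ellipsoid[OF prior]
  define A where "A = {\<theta> \<in> space \<mu>. exp_measure \<theta> \<in> {exp_measure \<theta> | \<theta>. \<theta> \<in> sobolev_ellipsoid p Q \<and>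
                   hellinger_dist (exp_density \<theta>0) (exp_density \<theta>) > M * e}}"
  define U where "U = {\<theta> \<in> sobolev_ellipsoid p Q. (\<Sum>j. (\<theta> (Suc j) - \<theta>0 (Suc j))\<^sup>2) \<le> r * e\<^sup>2}"
  let ?l = "likelihood n X" and ?L = "exp_family_KL \<theta>0"
  let ?num = "LINT \<theta>:A|\<mu>. ?l \<theta>" and ?den = "LINT \<theta>|\<mu>. ?l \<theta>"
  have post: "post = ?num / ?den" by (simp add: post_def posterior_def A_def)
  define l0 where "l0 = ?l \<theta>0"
  have l_pos: "0 < ?l \<theta>" if "\<theta> \<in> sobolev_ellipsoid p Q" for \<theta>
    unfolding likelihood_def by (intro prod_pos ballI exp_density_facts(4)[OF p that])
  have l0: "0 < l0" unfolding l0_def by (rule l_pos[OF \<theta>0])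
  have l_eq: "?l \<theta> = l0 * exp ((\<Sum>i<n. centred_log_ratio \<theta>0 \<theta> (X i)) - real n * ?L \<theta>)"
    if "\<theta> \<in> sobolev_ellipsoid p Q" for \<theta>
    unfolding l0_def by (rule likelihood_exp_family[OF p \<theta>0 that])
  have num0: "0 \<le> ?num"
    unfolding set_lebesgue_integral_def
    by (intro integral_nonneg_AE AE_I2) (auto simp: space less_imp_le[OF l_pos])
  have den0: "0 \<le> ?den"
    by (intro integral_nonneg_AE AE_I2) (auto simp: space less_imp_le[OF l_pos])
  show "0 \<le> post" unfolding post using num0 den0 by simp
  define x where "x = l0 * exp (- (real n * e\<^sup>2 * (M\<^sup>2 / 2 - C1)))"
  have x0: "0 \<le> x" using l0 by (simp add: x_def)
  have num: "?num \<le> x"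
  proof (cases "integrable \<mu> (\<lambda>\<theta>. indicator A \<theta> *\<^sub>R ?l \<theta>)")
    case True
    show ?thesis unfolding set_lebesgue_integral_def
    proof (rule integral_le_const[OF True], rule AE_I2)
      fix \<theta> assume "\<theta> \<in> space \<mu>"
      show "indicator A \<theta> *\<^sub>R ?l \<theta> \<le> x"
      proof (cases "\<theta> \<in> A")
        case True
        then obtain \<theta>' where \<theta>: "\<theta> \<in> sobolev_ellipsoid p Q" and \<theta>': "\<theta>' \<in> sobolev_ellipsoid p Q"
          "exp_measure \<theta> = exp_measure \<theta>'" "hellinger_dist (exp_density \<theta>0) (exp_density \<theta>') > M * e"
          by (auto simp: A_def space)
        then have "M * e < hellinger_dist (exp_density \<theta>0) (exp_density \<theta>)"
          using hellinger_dist_exp_measure_eq[OF p \<theta> \<theta>'(1,2) exp_density_measurable] by simp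
        then have "(M * e)\<^sup>2 \<le> (hellinger_dist (exp_density \<theta>0) (exp_density \<theta>))\<^sup>2"
          using M by (intro power_mono) auto
        also have "\<dots> \<le> ?L \<theta>" by (rule exp_family_KL_facts(2)[OF p \<theta>0 \<theta>])
        finally have "real n * (M * e)\<^sup>2 \<le> real n * ?L \<theta>" by (rule mult_left_mono) simp
        then have "(\<Sum>i<n. centred_log_ratio \<theta>0 \<theta> (X i)) - real n * ?L \<theta> \<le> - (real n * e\<^sup>2 * (M\<^sup>2 / 2 - C1))"
          using linear[OF \<theta>] by (simp add: power_mult_distrib algebra_simps abs_le_iff)
        then show ?thesis using True l0 by (simp add: l_eq[OF \<theta>] x_def)
      qed (simp add: x0)
    qed
  next
    \<comment> \<open>the integral of a non-integrable function is \<open>0\<close>\<close>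
    case False
    then show ?thesis unfolding set_lebesgue_integral_def by (simp add: not_integrable_integral_eq x0)
  qed
  show "post \<le> exp (- (real n * e\<^sup>2 * (M\<^sup>2 / 2 - 2 * C1 - 3 / 2 * C2))) / \<beta>"
  proof (cases "integrable \<mu> ?l")
    \<comment> \<open>the denominator is then \<open>0\<close>, and so is the quotient\<close>
    case False
    then show ?thesis using \<beta> by (simp add: post not_integrable_integral_eq)
  next
    case True
    have U: "\<beta> \<le> measure \<mu> U" using mass by (simp add: U_def)
    \<comment> \<open>non-measurable sets have measure \<open>0\<close>, so positive mass entails measurability\<close>
    then have U_sets: "U \<in> sets \<mu>"
      using \<beta> measure_notin_sets[of U \<mu>] by force
    define y where "y = l0 * exp (- (real n * e\<^sup>2 * (C1 + 3 / 2 * C2)))"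
    have y0: "0 < y" using l0 by (simp add: y_def)
    have "y * \<beta> \<le> y * measure \<mu> U" using U y0 by simp
    also have "\<dots> = (LINT \<theta>|\<mu>. y * indicator U \<theta>)" using U_sets by (simp add: sets.sets_into_space Int_absorb2)
    also have "\<dots> \<le> ?den"
    proof (rule integral_mono[OF _ True])
      show "integrable \<mu> (\<lambda>\<theta>. y * indicator U \<theta>)"
        using U_sets by (intro integrable_mult_right) (simp add: emeasure_eq_measure)
      fix \<theta> assume "\<theta> \<in> space \<mu>"
      then have \<theta>: "\<theta> \<in> sobolev_ellipsoid p Q" by (simp add: space)
      show "y * indicator U \<theta> \<le> ?l \<theta>"
      proof (cases "\<theta> \<in> U")
        case True
        have "?L \<theta> \<le> C2 * (\<Sum>j. (\<theta> (Suc j) - \<theta>0 (Suc j))\<^sup>2)"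
          unfolding C2_def by (rule exp_family_KL_facts(3)[OF p \<theta>0 \<theta>])
        also have "\<dots> \<le> C2 * e\<^sup>2"
        proof (rule mult_left_mono)
          have "r * e\<^sup>2 \<le> 1 * e\<^sup>2" by (rule mult_right_mono[OF r]) simp
          then show "(\<Sum>j. (\<theta> (Suc j) - \<theta>0 (Suc j))\<^sup>2) \<le> e\<^sup>2" using True by (simp add: U_def)
        qed (simp add: C2_def)
        finally have "real n * ?L \<theta> \<le> real n * (C2 * e\<^sup>2)" by (rule mult_left_mono) simp
        then have "- (real n * e\<^sup>2 * (C1 + 3 / 2 * C2)) \<le> (\<Sum>i<n. centred_log_ratio \<theta>0 \<theta> (X i)) - real n * ?L \<theta>"
          using linear[OF \<theta>] by (simp add: algebra_simps abs_le_iff)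
        then show ?thesis using True l0 by (simp add: l_eq[OF \<theta>] y_def)
      qed (simp add: less_imp_le[OF l_pos[OF \<theta>]])
    qed
    finally have den: "y * \<beta> \<le> ?den" .
    have "post \<le> x / (y * \<beta>)"
      unfolding post using num den num0 y0 \<beta> x0 by (intro frac_le) auto
    also have "\<dots> = exp (- (real n * e\<^sup>2 * (M\<^sup>2 / 2 - C1)) - - (real n * e\<^sup>2 * (C1 + 3 / 2 * C2))) / \<beta>"
      unfolding exp_diff using l0 by (simp add: x_def y_def)
    also have "- (real n * e\<^sup>2 * (M\<^sup>2 / 2 - C1)) - - (real n * e\<^sup>2 * (C1 + 3 / 2 * C2)) =
        - (real n * e\<^sup>2 * (M\<^sup>2 / 2 - 2 * C1 - 3 / 2 * C2))"
      by (simp add: algebra_simps)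
    finally show ?thesis .
  qed
qed

section \<open>Posterior contraction\<close>

theorem theorem1:
  fixes p :: nat and Q B1 c1 c2 :: real
    and \<pi> :: "nat \<Rightarrow> (nat \<Rightarrow> real) measure"
    and \<theta>0 :: "nat \<Rightarrow> real"
    and \<epsilon> :: "nat \<Rightarrow> real"
  assumes "p \<ge> 1" and "Q > 0"
    and "\<And>n. n \<ge> 1 \<Longrightarrow> prior_on_ellipsoid p Q (\<pi> n)"
    and "\<theta>0 \<in> sobolev_ellipsoid p Q"
    and "B1\<^sup>2 = exp (- 8 * sobolev_B p Q)"
    and "\<And>n. \<epsilon> n = real n powr (- (real p / (2 * real p + 1)))"
    and "c1 > 0" and "c2 > 0"
    and "\<forall>\<^sub>F n in sequentially.
           measure (\<pi> n) {\<theta> \<in> sobolev_ellipsoid p Q.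
               (\<Sum>j. (\<theta> (Suc j) - \<theta>0 (Suc j))\<^sup>2) \<le> B1\<^sup>2 * (\<epsilon> n)\<^sup>2}
             \<ge> c2 * exp (- c1 * real n * (\<epsilon> n)\<^sup>2)"
  shows "\<exists>M0>0. \<forall>M\<ge>M0.
           AE X in (\<Pi>\<^sub>M i\<in>(UNIV :: nat set). exp_measure \<theta>0).
             (\<lambda>n. posterior (\<pi> n) n X
                {exp_measure \<theta> | \<theta>. \<theta> \<in> sobolev_ellipsoid p Q \<and>
                   hellinger_dist (exp_density \<theta>0) (exp_density \<theta>) > M * \<epsilon> n})
             \<longlonglongrightarrow> 0"
proof -
  note p = assms(1) and prior = assms(3) and \<theta>0 = assms(4) and \<epsilon> = assms(6) and mass = assms(9)
  define B where "B = sobolev_B p Q"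
  define K where "K = exp 17 * (32 + 2 * exp (2 * B))"
  define c where "c = exp (- 10 * B) / 2"
  define C1 where "C1 = 2 * Q * c + K / (2 * c)"
  define C2 where "C2 = exp (6 * B) / 2"
  \<comment> \<open>with \<open>M\<^sup>2 / 2 \<ge> \<gamma>\<close> the exponent \<open>M\<^sup>2 / 2 - 2 * C1 - 3 / 2 * C2\<close> of the posterior bound exceeds the
    prior mass exponent \<open>c1\<close> by at least one\<close>
  define \<gamma> where "\<gamma> = 2 * C1 + 3 / 2 * C2 + c1 + 1"
  let ?S = "\<Pi>\<^sub>M i\<in>(UNIV :: nat set). exp_measure \<theta>0"
  let ?C = "\<lambda>M n. {exp_measure \<theta> | \<theta>. \<theta> \<in> sobolev_ellipsoid p Q \<and>
                   hellinger_dist (exp_density \<theta>0) (exp_density \<theta>) > M * \<epsilon> n}"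
  have "0 \<le> K" "0 < c" "0 < C2" by (simp_all add: K_def c_def C2_def add_nonneg_nonneg)
  then have C1: "0 \<le> C1" using \<open>Q > 0\<close> by (simp add: C1_def)
  have \<gamma>: "1 \<le> \<gamma>" using C1 \<open>0 < C2\<close> \<open>c1 > 0\<close> by (simp add: \<gamma>_def)
  have B0: "0 \<le> B" unfolding B_def by (rule sobolev_B_nonneg[OF assms(2,1)])
  have r: "B1\<^sup>2 \<le> 1" unfolding assms(5) using B0 by (simp add: B_def)
  have \<epsilon>0: "0 \<le> \<epsilon> n" for n by (simp add: \<epsilon>)
  note rate = rate_identities[OF _ \<epsilon>]
  have vanish: "(\<lambda>n. exp (- effective_dimension p n) / c2) \<longlonglongrightarrow> 0"
  proof -
    have "filterlim (\<lambda>n. - effective_dimension p n) at_bot sequentially"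
      using effective_dimension_at_top by (simp add: filterlim_uminus_at_bot)
    then have "(\<lambda>n. exp (- effective_dimension p n)) \<longlonglongrightarrow> 0"
      by (rule filterlim_compose[OF exp_at_bot])
    from tendsto_divide_zero[OF this, of c2] show ?thesis .
  qed
  have conclude: "(\<lambda>n. posterior (\<pi> n) n X (?C M n)) \<longlonglongrightarrow> 0"
    if M: "sqrt (2 * \<gamma>) \<le> M" and X: "\<forall>\<^sub>F n in sequentially.
      energy (shrinkage p (\<epsilon> n)) (feature_sum (centred_trig \<theta>0) n X)
        \<le> exp 17 * (32 + 2 * exp (2 * sobolev_B p Q)) * (real n * \<epsilon> n)\<^sup>2" for M X
  proof -
    have M0: "0 \<le> M" using M \<gamma> by (smt (verit) real_sqrt_ge_zero)
    have M2: "\<gamma> \<le> M\<^sup>2 / 2"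
      using power_mono[OF M, of 2] \<gamma> by simp
    have bound: "\<forall>\<^sub>F n in sequentially. 0 \<le> posterior (\<pi> n) n X (?C M n) \<and>
        posterior (\<pi> n) n X (?C M n) \<le> exp (- effective_dimension p n) / c2"
      using X mass eventually_ge_at_top[of 1]
    proof eventually_elim
      case (elim n)
      let ?e = "\<epsilon> n"
      have n: "0 < n" using elim(3) by simp
      have N: "1 \<le> effective_dimension p n"
        using elim(3) by (simp add: effective_dimension_def ge_one_powr_ge_zero)
      note w = shrinkage_sum(1)[OF p N rate(1)[OF n]]
      have "\<bar>feature_sum (centred_trig \<theta>0) n X j\<bar> \<le> real n * (2 * sqrt 2)" for j
        by (rule feature_sum_bound[of "centred_trig \<theta>0", OF centred_trig_bound[OF p \<theta>0]])
      note linear = linear_statistic_bound[OF p \<theta>0 _ w elim(1) this, folded B_def, folded K_def c_def, folded C1_def]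
      have \<beta>: "0 < c2 * exp (- c1 * real n * ?e\<^sup>2)" using \<open>c2 > 0\<close> by simp
      have Me: "0 \<le> M * ?e" using M0 \<epsilon>0 by simp
      note post = posterior_bound[OF p \<theta>0 prior[OF elim(3)] linear elim(2) \<beta> r Me, folded B_def, folded C2_def]
      have "real n * ?e\<^sup>2 * \<gamma> \<le> real n * ?e\<^sup>2 * (M\<^sup>2 / 2)"
        using M2 by (intro mult_left_mono) auto
      then have "- (real n * ?e\<^sup>2 * (M\<^sup>2 / 2 - 2 * C1 - 3 / 2 * C2)) - (- c1 * real n * ?e\<^sup>2) \<le> - (real n * ?e\<^sup>2)"
        by (simp add: \<gamma>_def algebra_simps)
      then have "exp (- (real n * ?e\<^sup>2 * (M\<^sup>2 / 2 - 2 * C1 - 3 / 2 * C2))) / exp (- c1 * real n * ?e\<^sup>2) \<le> exp (- (real n * ?e\<^sup>2))"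
        unfolding exp_diff[symmetric] by simp
      then have "exp (- (real n * ?e\<^sup>2 * (M\<^sup>2 / 2 - 2 * C1 - 3 / 2 * C2))) / exp (- c1 * real n * ?e\<^sup>2) / c2 \<le> exp (- (real n * ?e\<^sup>2)) / c2"
        using \<open>c2 > 0\<close> by (intro divide_right_mono) auto
      then show ?case using post rate(2)[OF n] by (simp add: mult.commute)
    qed
    show ?thesis
      by (rule tendsto_sandwich[OF _ _ tendsto_const vanish])
         (use bound in \<open>auto elim: eventually_mono\<close>)
  qed
  show ?thesis
  proof (intro exI[of _ "sqrt (2 * \<gamma>)"] conjI allI impI)
    show "0 < sqrt (2 * \<gamma>)" using \<gamma> by simp
    fix M assume M: "sqrt (2 * \<gamma>) \<le> M"
    show "AE X in ?S. (\<lambda>n. posterior (\<pi> n) n X (?C M n)) \<longlonglongrightarrow> 0"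
      using empirical_energy_AE_bound[OF p \<theta>0 \<epsilon>]
      by (rule AE_mp) (intro AE_I2 impI conclude[OF M])
  qed
qed

end
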